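(* Let $G=(V,E)$ be a finite graph, let $w\in\mathbb{R}^n_{\ge0}$ be a nonnegative vector, and let $\Gamma=aa'+bb'\in\mathbb{R}^{n\times n}$ for some nonnegative column vectors $a,b\in\mathbb{R}^n_{\ge0}$, where $v'$ denotes the transpose of $v$. Let $$Z_{\mathrm{hom}}(G;w,\Gamma)=\sum_{\sigma\in\{1,\dots,n\}^{|V|}}\ \prod_{i\in V}w_{\sigma_i}\prod_{(i,j)\in E}\Gamma_{\sigma_i,\sigma_j},$$ and let $Z_{\mathrm B}(G;w,\Gamma)$ and $Z_{\mathrm{MF}}(G;w,\Gamma)$ be the Bethe and naïve mean-field partition functions of this graphical model. Then $$Z_{\mathrm{MF}}(G;w,\Gamma)\le Z_{\mathrm B}(G;w,\Gamma)\le Z_{\mathrm{hom}}(G;w,\Gamma).$$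
   Context: Graphs are finite, simple and undirected. Graphical models: for a finite set $\mathcal{X}$ and a hypergraph $G=(V,\mathcal{A})$ with potentials $\phi_i:\mathcal{X}\to\mathbb{R}_{\ge0}$ ($i\in V$) and $\psi_\alpha:\mathcal{X}^{|\alpha|}\to\mathbb{R}_{\ge0}$ ($\alpha\in\mathcal{A}$), the local marginal polytope $\mathcal{T}$ is the set of nonnegative $\tau=(\tau_i(x_i),\tau_\alpha(x_\alpha))$ with $\sum_{x_i}\tau_i(x_i)=1$ for all $i\in V$ and $\sum_{x_{\alpha\setminus i}}\tau_\alpha(x_\alpha)=\tau_i(x_i)$ for all $\alpha\in\mathcal{A}$, $i\in\alpha$ and $x_i \in \mathcal{X}$. For $\tau\in\mathcal{T}$, $$\log Z_{\mathrm B}(G,\tau;\phi,\psi)=\sum_{i\in V}\sum_{x_i}\tau_i(x_i)\log\phi_i(x_i)+\sum_{\alpha\in\mathcal{A}}\sum_{x_\alpha}\tau_\alpha(x_\alpha)\log\psi_\alpha(x_\alpha)-\sum_{i\in V}\sum_{x_i}\tau_i(x_i)\log\tau_i(x_i)-\sum_{\alpha\in\mathcal{A}}\sum_{x_\alpha}\tau_\alpha(x_\alpha)\log\frac{\tau_\alpha(x_\alpha)}{\prod_{i\in\alpha}\tau_i(x_i)}$$ with the usual conventions: $0\log 0=0$ (so a term with zero $\tau$-coefficient is $0$), $\log 0=-\infty$ when multiplied by a positive coefficient, and $e^{-\infty}=0$. The Bethe partition function is $Z_{\mathrm B}(G;\phi,\psi)=\max_{\tau\in\mathcal{T}}Z_{\mathrm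 B}(G,\tau;\phi,\psi)$. The naïve mean-field partition function $Z_{\mathrm{MF}}(G;\phi,\psi)$ is the maximum of the same expression over those $\tau\in\mathcal{T}$ with $\tau_\alpha(x_\alpha)=\prod_{i\in\alpha}\tau_i(x_i)$ for all $\alpha\in\mathcal{A}$. For the weighted graph homomorphism model, $\mathcal{X}=\{1,\dots,n\}$, $\mathcal{A}=E$, $\phi_i(\sigma_i)=w_{\sigma_i}$ and $\psi_{ij}(\sigma_i,\sigma_j)=\Gamma_{\sigma_i,\sigma_j}$. *)

theory Defs
  imports "HOL-Analysis.Analysis"
begin

section \<open>Bethe and naive mean-field partition functions of a graphical model\<close>

text \<open>
  The alphabet is a finite type \<open>'x\<close>, the hypergraph is given by a vertex set \<open>V\<close> and a set \<open>A\<close> of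
  hyperedges (subsets of \<open>V\<close>).  A configuration on a vertex set \<open>U\<close> is an extensional function
  on \<open>U\<close>, so that there are exactly \<open>CARD('x) ^ card U\<close> of them.
\<close>

abbreviation configs :: "'v set \<Rightarrow> ('v \<Rightarrow> 'x) set" where
  "configs U \<equiv> U \<rightarrow>\<^sub>E UNIV"

type_synonym ('v, 'x) pseudomarginal = "('v \<Rightarrow> 'x \<Rightarrow> real) \<times> ('v set \<Rightarrow> ('v \<Rightarrow> 'x) \<Rightarrow> real)"

text \<open>
  Values of a pseudomarginal at arguments outside \<open>V\<close>, \<open>A\<close> and \<open>configs \<alpha>\<close> are unconstrained;
  nothing below depends on them.
\<close>

definition local_marginal_polytope ::
    "'v set \<Rightarrow> 'v set set \<Rightarrow> ('v, 'x::finite) pseudomarginal set" where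
  "local_marginal_polytope V A = {(\<tau>v, \<tau>e).
     (\<forall>i\<in>V. \<forall>x. 0 \<le> \<tau>v i x) \<and>
     (\<forall>\<alpha>\<in>A. \<forall>y\<in>configs \<alpha>. 0 \<le> \<tau>e \<alpha> y) \<and>
     (\<forall>i\<in>V. (\<Sum>x\<in>UNIV. \<tau>v i x) = 1) \<and>
     (\<forall>\<alpha>\<in>A. \<forall>i\<in>\<alpha>. \<forall>x. (\<Sum>y | y \<in> configs \<alpha> \<and> y i = x. \<tau>e \<alpha> y) = \<tau>v i x)}"

definition mean_field_set ::
    "'v set \<Rightarrow> 'v set set \<Rightarrow> ('v, 'x::finite) pseudomarginal set" where
  "mean_field_set V A = {(\<tau>v, \<tau>e). (\<tau>v, \<tau>e) \<in> local_marginal_polytope V A \<and>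
     (\<forall>\<alpha>\<in>A. \<forall>y\<in>configs \<alpha>. \<tau>e \<alpha> y = (\<Prod>i\<in>\<alpha>. \<tau>v i (y i)))}"

text \<open>Logarithm on \<open>[0, \<infinity>)\<close> with \<open>log 0 = -\<infinity>\<close>, and its inverse with \<open>exp (-\<infinity>) = 0\<close>.\<close>

definition ext_ln :: "real \<Rightarrow> ereal" where
  "ext_ln p = (if p = 0 then -\<infinity> else ereal (ln p))"

definition ext_exp :: "ereal \<Rightarrow> real" where
  "ext_exp u = (if u = -\<infinity> then 0 else exp (real_of_ereal u))"

text \<open>
  The products \<open>ereal t * ext_ln p\<close> follow the stated conventions because \<open>0 * -\<infinity> = 0\<close> in
  \<open>ereal\<close>; no summand is ever \<open>\<infinity>\<close>.  The entropy terms are finite: on the local marginal polytope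
  a vanishing \<open>\<Prod>i\<in>\<alpha>. \<tau>v i (y i)\<close> forces \<open>\<tau>e \<alpha> y = 0\<close>, so every \<open>ln\<close> of \<open>0\<close> or of a quotient
  by \<open>0\<close> has coefficient \<open>0\<close>.
\<close>

definition log_bethe ::
    "'v set \<Rightarrow> 'v set set \<Rightarrow> ('v \<Rightarrow> 'x::finite \<Rightarrow> real) \<Rightarrow> ('v set \<Rightarrow> ('v \<Rightarrow> 'x) \<Rightarrow> real)
     \<Rightarrow> ('v, 'x) pseudomarginal \<Rightarrow> ereal" where
  "log_bethe V A \<phi> \<psi> = (\<lambda>(\<tau>v, \<tau>e).
       (\<Sum>i\<in>V. \<Sum>x\<in>UNIV. ereal (\<tau>v i x) * ext_ln (\<phi> i x))
     + (\<Sum>\<alpha>\<in>A. \<Sum>y\<in>configs \<alpha>. ereal (\<tau>e \<alpha> y) * ext_ln (\<psi> \<alpha> y))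
     + ereal (- (\<Sum>i\<in>V. \<Sum>x\<in>UNIV. \<tau>v i x * ln (\<tau>v i x))
              - (\<Sum>\<alpha>\<in>A. \<Sum>y\<in>configs \<alpha>. \<tau>e \<alpha> y * ln (\<tau>e \<alpha> y / (\<Prod>i\<in>\<alpha>. \<tau>v i (y i))))))"

text \<open>The partition functions are maxima, not merely suprema.\<close>

definition Z_bethe ::
    "'v set \<Rightarrow> 'v set set \<Rightarrow> ('v \<Rightarrow> 'x::finite \<Rightarrow> real) \<Rightarrow> ('v set \<Rightarrow> ('v \<Rightarrow> 'x) \<Rightarrow> real) \<Rightarrow> real" where
  "Z_bethe V A \<phi> \<psi> =
     (GREATEST z. \<exists>\<tau>\<in>local_marginal_polytope V A. z = ext_exp (log_bethe V A \<phi> \<psi> \<tau>))"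

definition Z_mean_field ::
    "'v set \<Rightarrow> 'v set set \<Rightarrow> ('v \<Rightarrow> 'x::finite \<Rightarrow> real) \<Rightarrow> ('v set \<Rightarrow> ('v \<Rightarrow> 'x) \<Rightarrow> real) \<Rightarrow> real" where
  "Z_mean_field V A \<phi> \<psi> =
     (GREATEST z. \<exists>\<tau>\<in>mean_field_set V A. z = ext_exp (log_bethe V A \<phi> \<psi> \<tau>))"


section \<open>Weighted graph homomorphisms\<close>

definition finite_simple_graph :: "'v set \<Rightarrow> 'v set set \<Rightarrow> bool" where
  "finite_simple_graph V E \<longleftrightarrow> finite V \<and> (\<forall>e\<in>E. e \<subseteq> V \<and> card e = 2)"

definition hom_vertex_potential :: "real ^ 'n \<Rightarrow> 'v \<Rightarrow> 'n \<Rightarrow> real" where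
  "hom_vertex_potential w i x = w $ x"

text \<open>
  Edges are unordered, so the value on \<open>{i, j}\<close> is only meaningful for symmetric \<open>\<Gamma>\<close>,
  see \<open>hom_edge_potential_pair\<close>.
\<close>

definition hom_edge_potential :: "real ^ 'n ^ 'n \<Rightarrow> 'v set \<Rightarrow> ('v \<Rightarrow> 'n) \<Rightarrow> real" where
  "hom_edge_potential \<Gamma> e \<sigma> = (THE g. \<exists>i j. e = {i, j} \<and> g = \<Gamma> $ \<sigma> i $ \<sigma> j)"

lemma hom_edge_potential_pair:
  assumes "transpose \<Gamma> = \<Gamma>"
  shows "hom_edge_potential \<Gamma> {i, j} \<sigma> = \<Gamma> $ \<sigma> i $ \<sigma> j"
proof -
  have sym: "\<Gamma> $ x $ y = \<Gamma> $ y $ x" for x y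
    using assms by (metis transpose_def vec_lambda_beta)
  show ?thesis
    unfolding hom_edge_potential_def
    by (rule the_equality) (auto simp: doubleton_eq_iff sym)
qed

definition Z_hom :: "'v set \<Rightarrow> 'v set set \<Rightarrow> real ^ 'n \<Rightarrow> real ^ 'n ^ 'n \<Rightarrow> real" where
  "Z_hom V E w \<Gamma> =
     (\<Sum>\<sigma>\<in>configs V. (\<Prod>i\<in>V. w $ \<sigma> i) * (\<Prod>e\<in>E. hom_edge_potential \<Gamma> e \<sigma>))"

definition Z_bethe_hom :: "'v set \<Rightarrow> 'v set set \<Rightarrow> real ^ 'n \<Rightarrow> real ^ 'n ^ 'n \<Rightarrow> real" where
  "Z_bethe_hom V E w \<Gamma> = Z_bethe V E (hom_vertex_potential w) (hom_edge_potential \<Gamma>)"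

definition Z_mean_field_hom :: "'v set \<Rightarrow> 'v set set \<Rightarrow> real ^ 'n \<Rightarrow> real ^ 'n ^ 'n \<Rightarrow> real" where
  "Z_mean_field_hom V E w \<Gamma> = Z_mean_field V E (hom_vertex_potential w) (hom_edge_potential \<Gamma>)"

end

theory Submission
  imports Defs "HOL-Real_Asymp.Real_Asymp"
begin

text \<open>
  Expanding every \<open>\<Gamma>\<close> along an edge into its two rank-one terms turns the model into one with a binary
  variable per edge.  Splitting the edge marginals accordingly and using Gibbs' inequality and
  subadditivity of entropy, the Bethe functional at \<open>\<tau>\<close> is at most
  \<open>(\<Sum>i. log (\<Sum>x. w x * (\<Prod>e\<ni>i. a x + b x * z e i))) - (\<Sum>e. q e * (\<Sum>i\<in>e. log (z e i)) + H (q e))\<close>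
  for all \<open>z > 0\<close>, where \<open>q e\<close> is the probability of the second term on \<open>e\<close> and \<open>H\<close> the binary entropy.
  It remains to choose \<open>z\<close> so that this is at most the logarithm of the homomorphism sum.  This is done one
  edge \<open>uv\<close> at a time: the sum with the factors \<open>(a + b x)\<close> at \<open>u\<close> and \<open>(a + b y)\<close> at \<open>v\<close> is bilinear,
  \<open>A + B x + C y + D x y\<close>, the edge contributes \<open>A + D\<close>, and \<open>B C \<le> A D\<close> by a Griffiths-type correlation
  inequality.  Zero parameters are handled by perturbation.
\<close>

section \<open>Positive correlation across an edge\<close>

text \<open>For a two-element \<open>e\<close> this is the entry of
  \<open>\<Gamma> = a a' + b b'\<close> selected by \<open>\<sigma>\<close>. Products over
  \<open>e\<close> keep the two rank-one terms visible and require no orientation of the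
  edge.\<close>

definition edge_weight :: "('x \<Rightarrow> real) \<Rightarrow> ('x \<Rightarrow> real) \<Rightarrow> 'v set \<Rightarrow> ('v \<Rightarrow> 'x) \<Rightarrow> real" where
  "edge_weight a b e \<sigma> = (\<Prod>i\<in>e. a (\<sigma> i)) + (\<Prod>i\<in>e. b (\<sigma> i))"

text \<open>The homomorphism sum with weights that may depend on the vertex and with a variable edge
  set: eliminating an edge removes it from \<open>F\<close> and moves factors at its end points into
  \<open>\<omega>\<close>.\<close>

definition hom_sum ::
    "'v set \<Rightarrow> ('v \<Rightarrow> 'x \<Rightarrow> real) \<Rightarrow> ('x \<Rightarrow> real) \<Rightarrow> ('x \<Rightarrow> real) \<Rightarrow> 'v set set \<Rightarrow> real" where
  "hom_sum V \<omega> a b F =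
     (\<Sum>\<sigma>\<in>configs V. (\<Prod>i\<in>V. \<omega> i (\<sigma> i)) * (\<Prod>e\<in>F. edge_weight a b e \<sigma>))"

section \<open>Sums and products over configurations\<close>

lemma finite_configs: "finite V \<Longrightarrow> finite (configs V :: ('v \<Rightarrow> 'x::finite) set)"
  by (simp add: finite_PiE)

lemma configs_nonempty: "(configs V :: ('v \<Rightarrow> 'x) set) \<noteq> {}"
  by (simp add: PiE_eq_empty_iff)

lemma sum_configs_prod:
  fixes f :: "'v \<Rightarrow> 'x::finite \<Rightarrow> 'c::comm_semiring_1"
  assumes "finite V"
  shows "(\<Sum>\<sigma>\<in>configs V. \<Prod>i\<in>V. f i (\<sigma> i)) = (\<Prod>i\<in>V. \<Sum>x\<in>UNIV. f i x)"
  using assms by (subst prod_sum_PiE) auto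

lemma prod_mult_subset:
  fixes f g :: "'v \<Rightarrow> 'c::comm_monoid_mult"
  assumes "finite V" "e \<subseteq> V"
  shows "(\<Prod>i\<in>V. f i) * (\<Prod>i\<in>e. g i) = (\<Prod>i\<in>V. f i * (if i \<in> e then g i else 1))"
proof -
  have "(\<Prod>i\<in>V. if i \<in> e then g i else 1) = (\<Prod>i\<in>V \<inter> e. g i)"
    using assms(1) by (simp add: prod.inter_restrict)
  also have "V \<inter> e = e" using assms(2) by blast
  finally show ?thesis by (simp add: prod.distrib)
qed

text \<open>The two mixed terms are rewritten by \<open>p * p' + m * m' = ((p + m) * (p' + m') + (p
  - m) * (p' - m')) / 2\<close>, where \<open>p\<close> and \<open>m\<close> are
  \<open>a * b\<close> and \<open>b * a\<close> taken at the two copies of one end point, and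
  \<open>p'\<close>, \<open>m'\<close> those at the other. Each resulting factor is symmetric or
  antisymmetric under exchanging the copies.\<close>

lemma edge_weight_duplicate:
  assumes "card e = 2"
  shows "edge_weight a b e \<sigma> * edge_weight a b e \<sigma>' =
      (\<Prod>i\<in>e. a (\<sigma> i) * a (\<sigma>' i)) + (\<Prod>i\<in>e. b (\<sigma> i) * b (\<sigma>' i))
    + ((\<Prod>i\<in>e. a (\<sigma> i) * b (\<sigma>' i) + b (\<sigma> i) * a (\<sigma>' i))
     + (\<Prod>i\<in>e. a (\<sigma> i) * b (\<sigma>' i) - b (\<sigma> i) * a (\<sigma>' i))) / 2"
proof -
  obtain u v where "e = {u, v}" "u \<noteq> v" using assms by (auto simp: card_2_iff)
  then show ?thesis by (simp add: edge_weight_def field_simps)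
qed

text \<open>
  Ginibre's duplication trick.  By \<open>edge_weight_duplicate\<close> each edge factor of the doubled model is a
  positive combination of products over its end points of functions symmetric or antisymmetric under
  exchanging the two copies; once all edges are expanded the sum factorizes over \<open>V\<close>, where odd
  powers of the antisymmetric \<open>a x * b y - b x * a y\<close> vanish and even ones are nonnegative.
\<close>

lemma duplicated_sum_nonneg:
  fixes a b :: "'x::finite \<Rightarrow> real" and h :: "'v \<Rightarrow> 'x \<Rightarrow> 'x \<Rightarrow> real"
  assumes "finite F" "finite V" "\<And>e. e \<in> F \<Longrightarrow> e \<subseteq> V \<and> card e = 2"
    and "\<And>x. 0 \<le> a x" "\<And>x. 0 \<le> b x"
    and "\<And>i x y. 0 \<le> h i x y" "\<And>i x y. h i x y = h i y x"
  shows "0 \<le> (\<Sum>\<sigma>\<in>configs V. \<Sum>\<sigma>'\<in>configs V.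
      (\<Prod>i\<in>V. h i (\<sigma> i) (\<sigma>' i) * (a (\<sigma> i) * b (\<sigma>' i) - b (\<sigma> i) * a (\<sigma>' i)) ^ k i)
      * (\<Prod>e\<in>F. edge_weight a b e \<sigma> * edge_weight a b e \<sigma>'))"
  using assms(1,3,6,7)
proof (induction F arbitrary: h k rule: finite_induct)
  case empty
  let ?m = "\<lambda>x y. a x * b y - b x * a y"
  have "0 \<le> (\<Sum>x\<in>UNIV. \<Sum>y\<in>UNIV. h i x y * ?m x y ^ k i)" for i
  proof (cases "even (k i)")
    case True
    then show ?thesis using empty(2) by (intro sum_nonneg mult_nonneg_nonneg) auto
  next
    case False
    \<comment> \<open>An odd power changes sign when the two copies are exchanged, so the double sum
      equals its own negative and vanishes.\<close>
    have flip: "h i x y * ?m x y ^ k i = - (h i y x * ?m y x ^ k i)" for x y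
    proof -
      have "?m x y = - ?m y x" by simp
      then have "?m x y ^ k i = - (?m y x ^ k i)" using False by (metis power_minus_odd)
      then show ?thesis using empty(3)[of i x y] by (metis mult_minus_right)
    qed
    have "(\<Sum>x\<in>UNIV. \<Sum>y\<in>UNIV. h i x y * ?m x y ^ k i)
        = (\<Sum>x\<in>UNIV. \<Sum>y\<in>UNIV. - (h i y x * ?m y x ^ k i))"
      by (intro sum.cong refl) (rule flip)
    also have "\<dots> = - (\<Sum>x\<in>UNIV. \<Sum>y\<in>UNIV. h i y x * ?m y x ^ k i)"
      by (simp only: sum_negf)
    also have "(\<Sum>x\<in>UNIV. \<Sum>y\<in>UNIV. h i y x * ?m y x ^ k i)
        = (\<Sum>x\<in>UNIV. \<Sum>y\<in>UNIV. h i x y * ?m x y ^ k i)"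
      by (rule sum.swap)
    finally show ?thesis by simp
  qed
  then have "0 \<le> (\<Prod>i\<in>V. \<Sum>x\<in>UNIV. \<Sum>y\<in>UNIV. h i x y * ?m x y ^ k i)"
    by (intro prod_nonneg) auto
  also have "\<dots> = (\<Sum>\<sigma>\<in>configs V. \<Prod>i\<in>V. \<Sum>y\<in>UNIV. h i (\<sigma> i) y * ?m (\<sigma> i) y ^ k i)"
    by (rule sum_configs_prod[OF assms(2), symmetric])
  also have "\<dots> = (\<Sum>\<sigma>\<in>configs V. \<Sum>\<sigma>'\<in>configs V.
      \<Prod>i\<in>V. h i (\<sigma> i) (\<sigma>' i) * ?m (\<sigma> i) (\<sigma>' i) ^ k i)"
    by (intro sum.cong refl sum_configs_prod[OF assms(2), symmetric])
  finally show ?case by simp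
next
  case (insert e F)
  let ?m = "\<lambda>x y. a x * b y - b x * a y"
  let ?S = "\<lambda>h k. \<Sum>\<sigma>\<in>configs V. \<Sum>\<sigma>'\<in>configs V.
      (\<Prod>i\<in>V. h i (\<sigma> i) (\<sigma>' i) * ?m (\<sigma> i) (\<sigma>' i) ^ k i)
      * (\<Prod>e\<in>F. edge_weight a b e \<sigma> * edge_weight a b e \<sigma>')"
  \<comment> \<open>Symmetric factors at the end points of \<open>e\<close> are absorbed into
    \<open>h\<close>, antisymmetric ones raise the exponent \<open>k\<close> there by one. Both keep
    the form of the statement, which is why the induction leaves \<open>h\<close> and
    \<open>k\<close> arbitrary.\<close>
  define g where "g p = (\<lambda>i x y. h i x y * (if i \<in> e then p x y else (1::real)))" for p
  define k' where "k' = (\<lambda>i. k i + (if i \<in> e then 1 else 0))"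
  have e: "e \<subseteq> V" "card e = 2" using insert.prems(1) by auto
  have nn: "0 \<le> ?S (g p) k" if "\<And>x y. 0 \<le> p x y" "\<And>x y. p x y = p y x" for p
    using insert.prems that by (intro insert.IH) (auto simp: g_def)
  have nn': "0 \<le> ?S h k'" using insert.prems by (intro insert.IH) auto
  have ab: "(\<Prod>i\<in>V. h i (\<sigma> i) (\<sigma>' i) * ?m (\<sigma> i) (\<sigma>' i) ^ k i) * (\<Prod>i\<in>e. p (\<sigma> i) (\<sigma>' i))
      = (\<Prod>i\<in>V. g p i (\<sigma> i) (\<sigma>' i) * ?m (\<sigma> i) (\<sigma>' i) ^ k i)" for p \<sigma> \<sigma>'
    unfolding prod_mult_subset[OF assms(2) e(1)] g_def by (intro prod.cong) auto
  have ab': "(\<Prod>i\<in>V. h i (\<sigma> i) (\<sigma>' i) * ?m (\<sigma> i) (\<sigma>' i) ^ k i) * (\<Prod>i\<in>e. ?m (\<sigma> i) (\<sigma>' i))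
      = (\<Prod>i\<in>V. h i (\<sigma> i) (\<sigma>' i) * ?m (\<sigma> i) (\<sigma>' i) ^ k' i)" for \<sigma> \<sigma>'
    unfolding prod_mult_subset[OF assms(2) e(1)] k'_def by (intro prod.cong) auto
  have distr: "X * ((P + Q + (R + T) / 2) * Y) = X * P * Y + X * Q * Y + (X * R * Y + X * T * Y) / 2"
    for X P Q R T Y :: real by (simp add: field_simps)
  let ?pa = "\<lambda>x y. a x * a y" and ?pb = "\<lambda>x y. b x * b y" and ?pc = "\<lambda>x y. a x * b y + b x * a y"
  have "(\<Sum>\<sigma>\<in>configs V. \<Sum>\<sigma>'\<in>configs V.
      (\<Prod>i\<in>V. h i (\<sigma> i) (\<sigma>' i) * ?m (\<sigma> i) (\<sigma>' i) ^ k i)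
      * (\<Prod>e\<in>insert e F. edge_weight a b e \<sigma> * edge_weight a b e \<sigma>'))
     = ?S (g ?pa) k + ?S (g ?pb) k + (?S (g ?pc) k + ?S h k') / 2"
    using insert.hyps
    by (simp add: edge_weight_duplicate[OF e(2)] distr ab[where p = ?pa] ab[where p = ?pb]
        ab[where p = ?pc] ab' sum.distrib flip: sum_divide_distrib)
  also have "\<dots> \<ge> 0"
    using assms(4,5) by (intro add_nonneg_nonneg divide_nonneg_pos nn nn') (auto simp: algebra_simps)
  finally show ?case .
qed

text \<open>\<open>duplicated_sum_nonneg\<close> with exponent 1 at \<open>u\<close> and
  \<open>v\<close> and 0 elsewhere: expanding the two antisymmetric factors turns the doubled sum
  into \<open>2 * (S a a * S b b - S b a * S a b)\<close>.\<close>

lemma hom_sum_correlation: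
  fixes a b :: "'x::finite \<Rightarrow> real" and \<omega> :: "'v \<Rightarrow> 'x \<Rightarrow> real"
  assumes "finite F" "finite V" "\<And>e. e \<in> F \<Longrightarrow> e \<subseteq> V \<and> card e = 2"
    and "\<And>x. 0 \<le> a x" "\<And>x. 0 \<le> b x" "\<And>i x. 0 \<le> \<omega> i x"
    and "u \<in> V" "v \<in> V" "u \<noteq> v"
  defines "S \<equiv> \<lambda>f g. \<Sum>\<sigma>\<in>configs V.
      (\<Prod>i\<in>V. \<omega> i (\<sigma> i)) * (\<Prod>e\<in>F. edge_weight a b e \<sigma>) * (f (\<sigma> u) * g (\<sigma> v))"
  shows "S b a * S a b \<le> S a a * S b b"
proof -
  define W where "W \<sigma> = (\<Prod>i\<in>V. \<omega> i (\<sigma> i)) * (\<Prod>e\<in>F. edge_weight a b e \<sigma>)" for \<sigma>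
  let ?m = "\<lambda>x y. a x * b y - b x * a y"
  have SS: "S f g * S f' g' = (\<Sum>\<sigma>\<in>configs V. \<Sum>\<sigma>'\<in>configs V. W \<sigma> * W \<sigma>' *
      (f (\<sigma> u) * g (\<sigma> v) * (f' (\<sigma>' u) * g' (\<sigma>' v))))" for f g f' g'
    unfolding S_def W_def sum_product by (intro sum.cong refl) (simp add: mult_ac)
  have "0 \<le> (\<Sum>\<sigma>\<in>configs V. \<Sum>\<sigma>'\<in>configs V.
      (\<Prod>i\<in>V. (\<omega> i (\<sigma> i) * \<omega> i (\<sigma>' i)) * ?m (\<sigma> i) (\<sigma>' i) ^ (if i \<in> {u, v} then 1 else 0))
      * (\<Prod>e\<in>F. edge_weight a b e \<sigma> * edge_weight a b e \<sigma>'))"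
    by (rule duplicated_sum_nonneg) (use assms(1-6) in \<open>auto simp: mult_ac\<close>)
  also have "\<dots> = (\<Sum>\<sigma>\<in>configs V. \<Sum>\<sigma>'\<in>configs V.
      W \<sigma> * W \<sigma>' * (?m (\<sigma> u) (\<sigma>' u) * ?m (\<sigma> v) (\<sigma>' v)))"
  proof (intro sum.cong refl)
    fix \<sigma> \<sigma>' :: "'v \<Rightarrow> 'x"
    have m: "?m (\<sigma> u) (\<sigma>' u) * ?m (\<sigma> v) (\<sigma>' v) = (\<Prod>i\<in>{u, v}. ?m (\<sigma> i) (\<sigma>' i))"
      using assms(9) by simp
    have p: "(\<Prod>i\<in>V. (\<omega> i (\<sigma> i) * \<omega> i (\<sigma>' i)) * ?m (\<sigma> i) (\<sigma>' i) ^ (if i \<in> {u, v} then 1 else 0))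
      = (\<Prod>i\<in>V. \<omega> i (\<sigma> i) * \<omega> i (\<sigma>' i)) * (\<Prod>i\<in>{u, v}. ?m (\<sigma> i) (\<sigma>' i))"
      using assms(7,8) by (subst prod_mult_subset[OF assms(2)]) (auto intro!: prod.cong)
    show "(\<Prod>i\<in>V. (\<omega> i (\<sigma> i) * \<omega> i (\<sigma>' i)) * ?m (\<sigma> i) (\<sigma>' i) ^ (if i \<in> {u, v} then 1 else 0))
      * (\<Prod>e\<in>F. edge_weight a b e \<sigma> * edge_weight a b e \<sigma>') =
      W \<sigma> * W \<sigma>' * (?m (\<sigma> u) (\<sigma>' u) * ?m (\<sigma> v) (\<sigma>' v))"
      unfolding p unfolding m W_def prod.distrib by (simp only: mult_ac)
  qed
  also have "\<dots> = S a a * S b b + S b b * S a a - S b a * S a b - S a b * S b a"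
  proof -
    have "w * ((p * q' - q * p') * (r * s' - s * r')) = w * (p * r * (q' * s')) + w * (q * s * (p' * r'))
        - w * (q * r * (p' * s')) - w * (p * s * (q' * r'))" for w p q r s p' q' r' s' :: real
      by (simp add: algebra_simps)
    then show ?thesis unfolding SS by (simp only: sum.distrib sum_subtractf)
  qed
  finally show ?thesis by (simp add: mult.commute)
qed

section \<open>Eliminating the edges\<close>

text \<open>The entropy of the choice between the two rank-one terms. Since
  \<open>0 * ln 0 = 0\<close>, it vanishes at \<open>q = 0\<close> and \<open>q = 1\<close>.\<close>

definition bin_entropy :: "real \<Rightarrow> real" where
  "bin_entropy q = - (q * ln q) - (1 - q) * ln (1 - q)"

text \<open>Pointwise this is \<open>ln s \<le> s - 1\<close> at \<open>s = r x / p x\<close>.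
  Masses are left unnormalized: it is applied to the two parts of a split edge marginal, whose mass
  defects cancel only after both parts are added.\<close>

lemma gibbs_inequality:
  fixes p r :: "'a \<Rightarrow> real"
  assumes "\<And>x. x \<in> S \<Longrightarrow> 0 \<le> p x" "\<And>x. x \<in> S \<Longrightarrow> 0 \<le> r x"
    and "\<And>x. x \<in> S \<Longrightarrow> 0 < p x \<Longrightarrow> 0 < r x"
  shows "(\<Sum>x\<in>S. p x * ln (r x)) \<le> (\<Sum>x\<in>S. p x * ln (p x)) + (\<Sum>x\<in>S. r x) - (\<Sum>x\<in>S. p x)"
proof -
  have "p x * ln (r x) \<le> p x * ln (p x) + r x - p x" if x: "x \<in> S" for x
  proof (cases "p x = 0")
    case True
    then show ?thesis using assms(2)[OF x] by simp
  next
    case False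
    then have p: "0 < p x" using assms(1)[OF x] by simp
    then have r: "0 < r x" using assms(3)[OF x] by simp
    have "p x * ln (r x / p x) \<le> p x * (r x / p x - 1)"
      using p r by (intro mult_left_mono ln_le_minus_one) auto
    also have "p x * (r x / p x - 1) = r x - p x" using p by (simp add: field_simps)
    finally show ?thesis using p r by (simp add: ln_div right_diff_distrib)
  qed
  then have "(\<Sum>x\<in>S. p x * ln (r x)) \<le> (\<Sum>x\<in>S. p x * ln (p x) + r x - p x)"
    by (rule sum_mono)
  then show ?thesis by (simp add: sum.distrib sum_subtractf)
qed

text \<open>The two-point Gibbs variational principle, with equality at
  \<open>q = D / (A + D)\<close>.\<close>

lemma weighted_ln_le_ln_add:
  fixes A D q :: real
  assumes "0 < A" "0 < D" "0 < q" "q < 1"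
  shows "(1 - q) * ln A + q * ln D + bin_entropy q \<le> ln (A + D)"
proof -
  have "(1 - q) * ln (A / ((1 - q) * (A + D))) \<le> (1 - q) * (A / ((1 - q) * (A + D)) - 1)"
    using assms by (intro mult_left_mono ln_le_minus_one) auto
  moreover have "q * ln (D / (q * (A + D))) \<le> q * (D / (q * (A + D)) - 1)"
    using assms by (intro mult_left_mono ln_le_minus_one) auto
  moreover have "(1 - q) * (A / ((1 - q) * (A + D)) - 1) + q * (D / (q * (A + D)) - 1) = 0"
  proof -
    have "(1 - q) * (A / ((1 - q) * (A + D)) - 1) = A / (A + D) - (1 - q)"
      "q * (D / (q * (A + D)) - 1) = D / (A + D) - q"
      using assms by (simp_all add: right_diff_distrib)
    moreover have "A / (A + D) + D / (A + D) = 1"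
      using assms by (simp flip: add_divide_distrib)
    ultimately show ?thesis by linarith
  qed
  moreover have "ln (A / ((1 - q) * (A + D))) = ln A - ln (1 - q) - ln (A + D)"
    "ln (D / (q * (A + D))) = ln D - ln q - ln (A + D)"
    using assms by (simp_all add: ln_div ln_mult)
  ultimately have "(1 - q) * (ln A - ln (1 - q) - ln (A + D)) + q * (ln D - ln q - ln (A + D)) \<le> 0"
    by (metis add_mono)
  then show ?thesis by (simp add: bin_entropy_def algebra_simps)
qed

text \<open>
  In the main case \<open>x\<close> and \<open>y\<close> balance \<open>B * x = C * y\<close>, so that \<open>B * C \<le> A * D\<close> bounds the left-hand side
  by \<open>(sqrt A + t * sqrt D)\<^sup>2\<close> with \<open>t\<^sup>2 = x * y\<close>; the scale \<open>t\<close> minimizes this divided by \<open>t powr (2 * q)\<close>.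
\<close>

lemma bilinear_ln_bound:
  fixes A B C D q :: real
  assumes pos: "0 < A" "0 < B" "0 < C" "0 < D" and "B * C \<le> A * D" and "0 \<le> q" "q \<le> 1"
  shows "\<exists>x y. 0 < x \<and> 0 < y \<and>
    ln (A + B * x + C * y + D * (x * y)) \<le> ln (A + D) + q * (ln x + ln y) + bin_entropy q"
proof -
  consider "q = 0" | "q = 1" | "0 < q" "q < 1" using assms(6,7) by linarith
  then show ?thesis
  proof cases
    case 1
    \<comment> \<open>With \<open>q = 0\<close> the bilinear form itself has to be at most
      \<open>A + D\<close>. Since \<open>t \<le> 1\<close> gives \<open>t * t \<le> t\<close>, it
      suffices that \<open>(B + C + D) * t = D\<close>.\<close>
    define t where "t = D / (B + C + D)"
    have t: "0 < t" "t \<le> 1" using pos by (auto simp: t_def)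
    have "D * (t * t) \<le> D * t" using t pos by (intro mult_left_mono) (auto simp: mult_left_le)
    moreover have "(B + C + D) * t = D" using pos by (simp add: t_def)
    ultimately have "A + B * t + C * t + D * (t * t) \<le> A + D" by (simp add: algebra_simps)
    moreover have "0 < A + B * t + C * t + D * (t * t)" using pos t by (intro add_pos_pos mult_pos_pos)
    ultimately have "ln (A + B * t + C * t + D * (t * t)) \<le> ln (A + D)" by simp
    then show ?thesis using t 1 by (intro exI[of _ t]) (auto simp: bin_entropy_def)
  next
    case 2
    \<comment> \<open>Here the form has to be at most \<open>(A + D) * (t * t)\<close>. From
      \<open>A * t = A + (B + C)\<close> and \<open>1 \<le> t\<close> follows
      \<open>A + (B + C) * t \<le> A * (t * t)\<close>.\<close>
    define t where "t = 1 + (B + C) / A"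
    have t: "1 \<le> t" using pos by (simp add: t_def)
    have "A * t = A + (B + C)" using pos by (simp add: t_def field_simps)
    then have "A * (t * t) = A * t + (B + C) * t"
      by (metis distrib_right mult.assoc)
    moreover have "A * 1 \<le> A * t" using t pos by (intro mult_left_mono) auto
    ultimately have le: "A + B * t + C * t + D * (t * t) \<le> (A + D) * (t * t)"
      by (simp add: algebra_simps)
    have "0 < A + B * t + C * t + D * (t * t)" using pos t by (intro add_pos_pos mult_pos_pos) auto
    then have "ln (A + B * t + C * t + D * (t * t)) \<le> ln ((A + D) * (t * t))"
      using le by simp
    also have "\<dots> = ln (A + D) + (ln t + ln t)"
      using pos t by (simp add: ln_mult)
    finally show ?thesis using t 2 by (intro exI[of _ t]) (auto simp: bin_entropy_def)
  next
    case 3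
    \<comment> \<open>Stationarity of the quotient in \<open>t\<close> reads
      \<open>t * sqrt D * (1 - q) = q * sqrt A\<close>; at this \<open>t\<close> the bound
      \<open>(sqrt A + t * sqrt D)^2\<close> becomes \<open>A / (1 - q)^2\<close>.\<close>
    define t where "t = sqrt (A / D) * (q / (1 - q))"
    define x where "x = t * sqrt (C / B)"
    define y where "y = t * sqrt (B / C)"
    have t: "0 < t" using 3 pos by (simp add: t_def)
    have xy: "0 < x" "0 < y" using t pos by (simp_all add: x_def y_def)
    have Bx: "B * sqrt (C / B) = sqrt (B * C)" "C * sqrt (B / C) = sqrt (B * C)"
      using pos by (simp_all add: real_sqrt_divide real_sqrt_mult field_simps)
    have "sqrt (C / B) * sqrt (B / C) = 1"
      using pos by (simp flip: real_sqrt_mult)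
    then have xyt: "x * y = t * t" by (simp add: x_def y_def mult_ac)
    have "A + B * x + C * y + D * (x * y) = A + 2 * t * sqrt (B * C) + D * (t * t)"
      using Bx unfolding xyt by (simp add: x_def y_def mult.left_commute[of _ t])
    also have "\<dots> \<le> A + 2 * t * sqrt (A * D) + D * (t * t)"
      using t assms(5) by simp
    also have "sqrt (A * D) = D * sqrt (A / D)"
      using pos by (simp add: real_sqrt_divide real_sqrt_mult field_simps)
    also have "A + 2 * t * (D * sqrt (A / D)) + D * (t * t)
        = A + 2 * (D * (sqrt (A / D))\<^sup>2) * (q / (1 - q)) + D * (sqrt (A / D))\<^sup>2 * (q / (1 - q))\<^sup>2"
      by (simp add: t_def power2_eq_square algebra_simps)
    also have "D * (sqrt (A / D))\<^sup>2 = A" using pos by simp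
    also have "A + 2 * A * (q / (1 - q)) + A * (q / (1 - q))\<^sup>2 = A * (1 + q / (1 - q))\<^sup>2"
      by (simp add: power2_eq_square algebra_simps)
    also have "1 + q / (1 - q) = 1 / (1 - q)" using 3 by (simp add: field_simps)
    finally have le: "A + B * x + C * y + D * (x * y) \<le> A * (1 / (1 - q))\<^sup>2" .
    have "0 < A + B * x + C * y + D * (x * y)" using pos xy by (intro add_pos_pos mult_pos_pos) auto
    then have "ln (A + B * x + C * y + D * (x * y)) \<le> ln (A * (1 / (1 - q))\<^sup>2)"
      using le by simp
    also have "\<dots> = ln A - 2 * ln (1 - q)"
      using pos 3 by (simp add: ln_mult ln_div power2_eq_square)
    also have "\<dots> \<le> ln (A + D) + q * (ln x + ln y) + bin_entropy q"
    proof -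
      have "ln x + ln y = ln (t * t)" using xy by (simp add: ln_mult flip: xyt)
      also have "\<dots> = 2 * ln t" using t by (simp add: ln_mult)
      also have "\<dots> = ln A - ln D + 2 * (ln q - ln (1 - q))"
        using pos 3 by (simp add: t_def ln_mult ln_div ln_sqrt)
      finally have lxy: "ln x + ln y = ln A - ln D + 2 * (ln q - ln (1 - q))" .
      \<comment> \<open>Moving \<open>q * (ln x + ln y)\<close> to the left leaves
        \<open>(1 - q) * ln A + q * ln D + 2 * bin_entropy q\<close> there. One entropy is used up
        by the two-point variational principle, the other is the one on the right.\<close>
      show ?thesis
        unfolding lxy using weighted_ln_le_ln_add[OF pos(1,4) 3] by (simp add: bin_entropy_def algebra_simps)
    qed
    finally show ?thesis using xy by blast
  qed
qed

section \<open>Trading edges for vertex weights\<close>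

lemma edge_weight_pos:
  assumes "\<And>x. 0 < a x" "\<And>x. 0 < b x"
  shows "0 < edge_weight a b e \<sigma>"
  using assms by (simp add: edge_weight_def add_pos_pos prod_pos)

lemma hom_sum_pos:
  fixes a b :: "'x::finite \<Rightarrow> real"
  assumes "finite V" "\<And>x. 0 < a x" "\<And>x. 0 < b x" "\<And>i x. 0 < \<omega> i x"
  shows "0 < hom_sum V \<omega> a b F"
  unfolding hom_sum_def
  by (intro sum_pos mult_pos_pos prod_pos edge_weight_pos assms ballI finite_configs configs_nonempty)

text \<open>With the factors \<open>a x + b x * z i\<close> at its end points in place of the edge,
  the sum is bilinear in \<open>z u\<close> and \<open>z v\<close>; the edge itself gives only the
  two extreme coefficients, \<open>S a a + S b b\<close>. The correlation inequality is then the
  hypothesis of \<open>bilinear_ln_bound\<close>.\<close>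

lemma eliminate_edge:
  fixes a b :: "'x::finite \<Rightarrow> real" and \<omega> :: "'v \<Rightarrow> 'x \<Rightarrow> real"
  assumes F: "finite F" "finite V" "\<And>f. f \<in> F \<Longrightarrow> f \<subseteq> V \<and> card f = 2"
    and e: "e \<subseteq> V" "card e = 2" "e \<notin> F"
    and pos: "\<And>x. 0 < a x" "\<And>x. 0 < b x" "\<And>i x. 0 < \<omega> i x"
    and q: "0 \<le> q" "q \<le> 1"
  shows "\<exists>z. (\<forall>i. 0 < z i) \<and>
    ln (hom_sum V (\<lambda>i x. \<omega> i x * (if i \<in> e then a x + b x * z i else 1)) a b F)
      \<le> ln (hom_sum V \<omega> a b (insert e F)) + q * (\<Sum>i\<in>e. ln (z i)) + bin_entropy q"
proof -
  obtain u v where uv: "e = {u, v}" "u \<noteq> v" using e(2) by (auto simp: card_2_iff)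
  then have V: "u \<in> V" "v \<in> V" using e(1) by auto
  define S where "S f g = (\<Sum>\<sigma>\<in>configs V.
      (\<Prod>i\<in>V. \<omega> i (\<sigma> i)) * (\<Prod>e\<in>F. edge_weight a b e \<sigma>) * (f (\<sigma> u) * g (\<sigma> v)))"
    for f g :: "'x \<Rightarrow> real"
  have corr: "S b a * S a b \<le> S a a * S b b"
    unfolding S_def using pos by (intro hom_sum_correlation F V uv) (auto intro: less_imp_le)
  have S_pos: "0 < S f g" if "\<And>x. 0 < f x" "\<And>x. 0 < g x" for f g
    unfolding S_def using that pos
    by (intro sum_pos mult_pos_pos prod_pos ballI finite_configs configs_nonempty F edge_weight_pos)
  have ins: "hom_sum V \<omega> a b (insert e F) = S a a + S b b"
    unfolding hom_sum_def S_def sum.distrib[symmetric] using F(1) e(3) uv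
    by (intro sum.cong refl) (simp add: edge_weight_def algebra_simps)
  have split: "hom_sum V (\<lambda>i x. \<omega> i x * (if i \<in> e then a x + b x * z i else 1)) a b F
      = S a a + S b a * z u + S a b * z v + S b b * (z u * z v)" for z
    unfolding hom_sum_def S_def sum.distrib[symmetric] sum_distrib_right
  proof (intro sum.cong refl)
    fix \<sigma> :: "'v \<Rightarrow> 'x"
    have "(\<Prod>i\<in>V. \<omega> i (\<sigma> i) * (if i \<in> e then a (\<sigma> i) + b (\<sigma> i) * z i else 1))
        = (\<Prod>i\<in>V. \<omega> i (\<sigma> i)) * ((a (\<sigma> u) + b (\<sigma> u) * z u) * (a (\<sigma> v) + b (\<sigma> v) * z v))"
      by (subst prod_mult_subset[OF F(2) e(1), symmetric]) (use uv in simp)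
    then show "(\<Prod>i\<in>V. \<omega> i (\<sigma> i) * (if i \<in> e then a (\<sigma> i) + b (\<sigma> i) * z i else 1))
        * (\<Prod>e\<in>F. edge_weight a b e \<sigma>) =
      (\<Prod>i\<in>V. \<omega> i (\<sigma> i)) * (\<Prod>e\<in>F. edge_weight a b e \<sigma>) * (a (\<sigma> u) * a (\<sigma> v))
      + (\<Prod>i\<in>V. \<omega> i (\<sigma> i)) * (\<Prod>e\<in>F. edge_weight a b e \<sigma>) * (b (\<sigma> u) * a (\<sigma> v)) * z u
      + (\<Prod>i\<in>V. \<omega> i (\<sigma> i)) * (\<Prod>e\<in>F. edge_weight a b e \<sigma>) * (a (\<sigma> u) * b (\<sigma> v)) * z v
      + (\<Prod>i\<in>V. \<omega> i (\<sigma> i)) * (\<Prod>e\<in>F. edge_weight a b e \<sigma>) * (b (\<sigma> u) * b (\<sigma> v)) * (z u * z v)"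
      by (simp only:) (simp add: algebra_simps)
  qed
  obtain x y where xy: "0 < x" "0 < y"
    "ln (S a a + S b a * x + S a b * y + S b b * (x * y))
      \<le> ln (S a a + S b b) + q * (ln x + ln y) + bin_entropy q"
    using bilinear_ln_bound[OF S_pos S_pos S_pos S_pos corr q] pos by blast
  \<comment> \<open>Only \<open>z u\<close> and \<open>z v\<close> enter the bound; the value
    \<open>y\<close> elsewhere keeps \<open>z\<close> positive.\<close>
  show ?thesis
    by (rule exI[of _ "\<lambda>i. if i = u then x else y"], unfold split ins) (use xy uv in auto)
qed

text \<open>One application of \<open>eliminate_edge\<close> per edge. The induction leaves
  \<open>\<omega>\<close> arbitrary because each eliminated edge multiplies it by its factors; with
  no edges left, the sum factorizes over the vertices.\<close>

lemma edge_elimination: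
  fixes a b :: "'x::finite \<Rightarrow> real" and \<omega> :: "'v \<Rightarrow> 'x \<Rightarrow> real"
  assumes "finite F" "finite V" "\<And>e. e \<in> F \<Longrightarrow> e \<subseteq> V \<and> card e = 2"
    and "\<And>x. 0 < a x" "\<And>x. 0 < b x" "\<And>i x. 0 < \<omega> i x"
    and "\<And>e. e \<in> F \<Longrightarrow> 0 \<le> q e \<and> q e \<le> 1"
  shows "\<exists>z. (\<forall>e i. 0 < z e i) \<and>
    (\<Sum>i\<in>V. ln (\<Sum>x\<in>UNIV. \<omega> i x * (\<Prod>e | e \<in> F \<and> i \<in> e. a x + b x * z e i)))
      \<le> ln (hom_sum V \<omega> a b F) + (\<Sum>e\<in>F. q e * (\<Sum>i\<in>e. ln (z e i)) + bin_entropy (q e))"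
  using assms(1,3,6,7)
proof (induction F arbitrary: \<omega> rule: finite_induct)
  case empty
  have "(\<Sum>i\<in>V. ln (\<Sum>x\<in>UNIV. \<omega> i x)) = ln (hom_sum V \<omega> a b {})"
    using assms(2) empty(2)
    by (simp add: hom_sum_def sum_configs_prod ln_prod sum_pos less_imp_neq[symmetric])
  then show ?case by (intro exI[of _ "\<lambda>_ _. 1"]) simp
next
  case (insert e F)
  have e: "e \<subseteq> V" "card e = 2" "0 \<le> q e" "q e \<le> 1" using insert.prems by auto
  have "\<And>f. f \<in> F \<Longrightarrow> f \<subseteq> V \<and> card f = 2" using insert.prems by auto
  then obtain z where z: "\<And>i. 0 < z i"
    "ln (hom_sum V (\<lambda>i x. \<omega> i x * (if i \<in> e then a x + b x * z i else 1)) a b F)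
      \<le> ln (hom_sum V \<omega> a b (insert e F)) + q e * (\<Sum>i\<in>e. ln (z i)) + bin_entropy (q e)"
    using eliminate_edge[of F V e a b \<omega> "q e"] insert.hyps assms(2,4,5) insert.prems(2) e by blast
  define \<omega>' where "\<omega>' = (\<lambda>i x. \<omega> i x * (if i \<in> e then a x + b x * z i else 1))"
  have "0 < \<omega>' i x" for i x
    using insert.prems(2) z(1) assms(4,5) by (auto simp: \<omega>'_def intro!: mult_pos_pos add_pos_pos)
  then obtain z' where z': "\<And>e i. 0 < z' e i"
    "(\<Sum>i\<in>V. ln (\<Sum>x\<in>UNIV. \<omega>' i x * (\<Prod>e | e \<in> F \<and> i \<in> e. a x + b x * z' e i)))
      \<le> ln (hom_sum V \<omega>' a b F) + (\<Sum>e\<in>F. q e * (\<Sum>i\<in>e. ln (z' e i)) + bin_entropy (q e))"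
    using insert.IH[of \<omega>'] insert.prems by auto
  \<comment> \<open>As \<open>e\<close> is not in \<open>F\<close>, the bound from the induction
    hypothesis does not involve \<open>z'\<close> at \<open>e\<close>, and the parameters of the
    edge just eliminated can be put there.\<close>
  let ?z = "z'(e := z)"
  have "\<omega>' i x * (\<Prod>f | f \<in> F \<and> i \<in> f. a x + b x * z' f i)
      = \<omega> i x * (\<Prod>f | f \<in> insert e F \<and> i \<in> f. a x + b x * ?z f i)" for i x
  proof -
    have P: "(\<Prod>f | f \<in> F \<and> i \<in> f. a x + b x * ?z f i) = (\<Prod>f | f \<in> F \<and> i \<in> f. a x + b x * z' f i)"
      using insert.hyps(2) by (intro prod.cong) auto
    show ?thesis
    proof (cases "i \<in> e")
      case True
      then have "{f. f \<in> insert e F \<and> i \<in> f} = insert e {f \<in> F. i \<in> f}" by auto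
      then show ?thesis using True insert.hyps P by (simp add: \<omega>'_def)
    next
      case False
      then have "{f. f \<in> insert e F \<and> i \<in> f} = {f \<in> F. i \<in> f}" by auto
      then show ?thesis using False P by (simp add: \<omega>'_def)
    qed
  qed
  moreover have "(\<Sum>f\<in>insert e F. q f * (\<Sum>i\<in>f. ln (?z f i)) + bin_entropy (q f))
    = (q e * (\<Sum>i\<in>e. ln (z i)) + bin_entropy (q e))
      + (\<Sum>f\<in>F. q f * (\<Sum>i\<in>f. ln (z' f i)) + bin_entropy (q f))"
  proof -
    have "(\<Sum>f\<in>F. q f * (\<Sum>i\<in>f. ln (?z f i)) + bin_entropy (q f))
      = (\<Sum>f\<in>F. q f * (\<Sum>i\<in>f. ln (z' f i)) + bin_entropy (q f))"
      using insert.hyps(2) by (intro sum.cong) auto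
    then show ?thesis using insert.hyps by simp
  qed
  ultimately show ?case
    using z z' by (intro exI[of _ ?z]) (auto simp: \<omega>'_def[symmetric])
qed

section \<open>Entropy bounds for the Bethe functional\<close>

lemma sum_configs_marginal:
  fixes t :: "('v \<Rightarrow> 'x::finite) \<Rightarrow> real"
  assumes "finite e"
  shows "(\<Sum>y\<in>configs e. t y * g (y i)) = (\<Sum>x\<in>UNIV. (\<Sum>y | y \<in> configs e \<and> y i = x. t y) * g x)"
proof -
  have "(\<Sum>y\<in>configs e. t y * g (y i))
      = (\<Sum>x\<in>UNIV. \<Sum>y | y \<in> configs e \<and> y i = x. t y * g (y i))"
    by (rule sum.group[symmetric]) (use assms finite_configs in auto)
  then show ?thesis by (simp add: sum_distrib_right)
qed

lemma sum_configs_marginal_total: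
  fixes t :: "('v \<Rightarrow> 'x::finite) \<Rightarrow> real"
  assumes "finite e"
  shows "(\<Sum>y\<in>configs e. t y) = (\<Sum>x\<in>UNIV. \<Sum>y | y \<in> configs e \<and> y i = x. t y)"
  using sum_configs_marginal[OF assms, of t "\<lambda>_. 1"] by simp

text \<open>Gibbs' inequality against the product of the marginals divided by \<open>Q\<close>,
  which has the same mass \<open>Q\<close> as \<open>t\<close> because \<open>card e = 2\<close>.
  The term \<open>Q * ln Q\<close> accounts for \<open>t\<close> not being normalized.\<close>

lemma entropy_subadditive:
  fixes t :: "('v \<Rightarrow> 'x::finite) \<Rightarrow> real"
  assumes e: "card e = 2" and t: "\<And>y. y \<in> configs e \<Longrightarrow> 0 \<le> t y"
  defines "m \<equiv> \<lambda>i x. \<Sum>y | y \<in> configs e \<and> y i = x. t y"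
    and "Q \<equiv> \<Sum>y\<in>configs e. t y"
  shows "(\<Sum>i\<in>e. \<Sum>x\<in>UNIV. m i x * ln (m i x)) \<le> (\<Sum>y\<in>configs e. t y * ln (t y)) + Q * ln Q"
proof -
  have fin: "finite e" using e by (metis card.infinite zero_neq_numeral)
  note finc = finite_configs[OF fin]
  have m_ge: "t y \<le> m i (y i)" if "y \<in> configs e" for y i
    unfolding m_def using that t finc by (intro member_le_sum) auto
  have m_nn: "0 \<le> m i x" for i x unfolding m_def by (intro sum_nonneg) (use t in auto)
  have Q_nn: "0 \<le> Q" unfolding Q_def by (intro sum_nonneg) (use t in auto)
  have Q_ge: "t y \<le> Q" if "y \<in> configs e" for y
    unfolding Q_def using that t finc by (intro member_le_sum) auto
  define r where "r y = (\<Prod>i\<in>e. m i (y i)) / Q" for y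
  have "(\<Sum>y\<in>configs e. t y * ln (r y))
      \<le> (\<Sum>y\<in>configs e. t y * ln (t y)) + (\<Sum>y\<in>configs e. r y) - (\<Sum>y\<in>configs e. t y)"
  proof (rule gibbs_inequality)
    show "0 \<le> r y" for y unfolding r_def using m_nn Q_nn by (intro divide_nonneg_nonneg prod_nonneg) auto
    show "0 < r y" if "y \<in> configs e" "0 < t y" for y
      unfolding r_def using m_ge[OF that(1)] Q_ge[OF that(1)] that(2)
      by (intro divide_pos_pos prod_pos) (auto intro: less_le_trans)
  qed (use t in auto)
  also have "(\<Sum>y\<in>configs e. r y) = (\<Prod>i\<in>e. \<Sum>x\<in>UNIV. m i x) / Q"
    unfolding r_def by (simp add: sum_configs_prod[OF fin] flip: sum_divide_distrib)
  also have "(\<Prod>i\<in>e. \<Sum>x\<in>UNIV. m i x) = (\<Prod>i\<in>e. Q)"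
    unfolding m_def Q_def by (intro prod.cong refl sum_configs_marginal_total[symmetric] fin)
  \<comment> \<open>For \<open>Q = 0\<close> this holds through \<open>x / 0 = 0\<close>.\<close>
  also have "(\<Prod>i\<in>e. Q) / Q = Q" using e by (simp add: power2_eq_square)
  also have "(\<Sum>y\<in>configs e. t y * ln (r y))
      = (\<Sum>y\<in>configs e. (\<Sum>i\<in>e. t y * ln (m i (y i))) - t y * ln Q)"
  proof (intro sum.cong refl)
    fix y :: "'v \<Rightarrow> 'x" assume y: "y \<in> configs e"
    show "t y * ln (r y) = (\<Sum>i\<in>e. t y * ln (m i (y i))) - t y * ln Q"
    proof (cases "t y = 0")
      case False
      then have "0 < t y" using t[OF y] by simp
      then have "0 < m i (y i)" "0 < Q" for i
        using m_ge[OF y, of i] Q_ge[OF y] by linarith+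
      then have "ln (r y) = (\<Sum>i\<in>e. ln (m i (y i))) - ln Q"
        unfolding r_def by (subst ln_div) (auto simp: ln_prod fin prod_pos less_imp_neq[symmetric])
      then show ?thesis by (simp add: right_diff_distrib sum_distrib_left)
    qed simp
  qed
  also have "\<dots> = (\<Sum>y\<in>configs e. \<Sum>i\<in>e. t y * ln (m i (y i))) - Q * ln Q"
    by (simp add: sum_subtractf Q_def sum_distrib_right)
  also have "(\<Sum>y\<in>configs e. \<Sum>i\<in>e. t y * ln (m i (y i)))
      = (\<Sum>i\<in>e. \<Sum>y\<in>configs e. t y * ln (m i (y i)))"
    by (rule sum.swap)
  also have "\<dots> = (\<Sum>i\<in>e. \<Sum>x\<in>UNIV. m i x * ln (m i x))"
    by (subst sum_configs_marginal[OF fin]) (simp add: m_def)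
  finally show ?thesis by (simp add: Q_def)
qed

text \<open>Gibbs' inequality at each end point replaces the reference weights \<open>r i\<close> by
  the marginals \<open>m i\<close>, leaving a mass defect; \<open>entropy_subadditive\<close> then
  compares the marginals with \<open>s\<close> itself. It serves for each of the two parts of a
  split edge marginal.\<close>

lemma split_edge_bound:
  fixes s :: "('v \<Rightarrow> 'x::finite) \<Rightarrow> real" and c :: "'x \<Rightarrow> real" and m r :: "'v \<Rightarrow> 'x \<Rightarrow> real"
  assumes e: "card e = 2" and s: "\<And>y. y \<in> configs e \<Longrightarrow> 0 \<le> s y"
    and r: "\<And>i x. i \<in> e \<Longrightarrow> 0 \<le> r i x" "\<And>i x. i \<in> e \<Longrightarrow> 0 < m i x \<Longrightarrow> 0 < r i x"
    and m: "m = (\<lambda>i x. \<Sum>y | y \<in> configs e \<and> y i = x. s y)"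
    and Q: "Q = (\<Sum>y\<in>configs e. s y)"
  shows "(\<Sum>y\<in>configs e. s y * (\<Sum>i\<in>e. ln (r i (y i)))) - (\<Sum>y\<in>configs e. s y * ln (s y))
     \<le> Q * ln Q + (\<Sum>i\<in>e. (\<Sum>x\<in>UNIV. r i x) - Q)"
proof -
  have fin: "finite e" using e by (metis card.infinite zero_neq_numeral)
  have "(\<Sum>y\<in>configs e. s y * (\<Sum>i\<in>e. ln (r i (y i))))
      = (\<Sum>i\<in>e. \<Sum>y\<in>configs e. s y * ln (r i (y i)))"
    unfolding sum_distrib_left by (rule sum.swap)
  also have "\<dots> = (\<Sum>i\<in>e. \<Sum>x\<in>UNIV. m i x * ln (r i x))"
    by (subst sum_configs_marginal[OF fin]) (simp add: m)
  also have "\<dots> \<le> (\<Sum>i\<in>e. (\<Sum>x\<in>UNIV. m i x * ln (m i x)) + (\<Sum>x\<in>UNIV. r i x) - (\<Sum>x\<in>UNIV. m i x))"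
    by (intro sum_mono gibbs_inequality) (auto simp: r(1) r(2) m intro!: sum_nonneg s)
  also have "\<dots> = (\<Sum>i\<in>e. \<Sum>x\<in>UNIV. m i x * ln (m i x)) + (\<Sum>i\<in>e. (\<Sum>x\<in>UNIV. r i x) - Q)"
    using sum_configs_marginal_total[OF fin, of s] unfolding Q m
    by (simp add: sum.distrib sum_subtractf)
  also have "(\<Sum>i\<in>e. \<Sum>x\<in>UNIV. m i x * ln (m i x)) \<le> (\<Sum>y\<in>configs e. s y * ln (s y)) + Q * ln Q"
    using entropy_subadditive[OF e s] unfolding m Q by simp
  finally show ?thesis by simp
qed

text \<open>
  The edge marginal \<open>t\<close> is split as \<open>s0 + s1\<close> according to the two product terms of the edge weight;
  \<open>q\<close> is the total mass of the \<open>b\<close>-term.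
\<close>

lemma edge_free_energy_bound:
  fixes t :: "('v \<Rightarrow> 'x::finite) \<Rightarrow> real" and a b :: "'x \<Rightarrow> real" and M :: "'v \<Rightarrow> 'x \<Rightarrow> real"
  assumes e: "card e = 2" and pos: "\<And>x. 0 < a x" "\<And>x. 0 < b x" "\<And>i. 0 < z i"
    and t: "\<And>y. y \<in> configs e \<Longrightarrow> 0 \<le> t y"
    and M: "\<And>i x. i \<in> e \<Longrightarrow> (\<Sum>y | y \<in> configs e \<and> y i = x. t y) = M i x"
    and M1: "\<And>i. i \<in> e \<Longrightarrow> (\<Sum>x\<in>UNIV. M i x) = 1"
    and q: "q = (\<Sum>y\<in>configs e. t y * (\<Prod>i\<in>e. b (y i)) / edge_weight a b e y)"
  shows "(\<Sum>y\<in>configs e. t y * ln (edge_weight a b e y))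
      - (\<Sum>y\<in>configs e. t y * ln (t y / (\<Prod>i\<in>e. M i (y i))))
    \<le> (\<Sum>i\<in>e. \<Sum>x\<in>UNIV. M i x * ln (a x + b x * z i)) - q * (\<Sum>i\<in>e. ln (z i)) - bin_entropy q"
    and "0 \<le> q" "q \<le> 1"
proof -
  have fin: "finite e" using e by (metis card.infinite zero_neq_numeral)
  note finc = finite_configs[OF fin]
  obtain i0 where i0: "i0 \<in> e" using e by (metis card.empty equals0I zero_neq_numeral)
  define G where "G = edge_weight a b e"
  have G: "0 < G y" for y unfolding G_def by (rule edge_weight_pos[OF pos(1,2)])
  define s0 where "s0 y = t y * (\<Prod>i\<in>e. a (y i)) / G y" for y
  define s1 where "s1 y = t y * (\<Prod>i\<in>e. b (y i)) / G y" for y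
  have pp: "0 < (\<Prod>i\<in>e. a (y i))" "0 < (\<Prod>i\<in>e. b (y i))" for y :: "'v \<Rightarrow> 'x"
    using pos by (auto intro!: prod_pos)
  have s01: "s0 y + s1 y = t y" for y
  proof -
    have "s0 y + s1 y = t y * G y / G y"
      by (simp add: s0_def s1_def G_def edge_weight_def ring_distribs add_divide_distrib)
    then show ?thesis using G[of y] by simp
  qed
  have s0: "0 \<le> s0 y" and s1: "0 \<le> s1 y" if "y \<in> configs e" for y
    using t[OF that] G[of y] pp[of y] by (auto simp: s0_def s1_def)
  have q1: "q = (\<Sum>y\<in>configs e. s1 y)" by (simp add: q s1_def G_def)
  have "(\<Sum>y\<in>configs e. t y) = 1"
    using sum_configs_marginal_total[OF fin, of t i0] M[OF i0] M1[OF i0] by simp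
  then have q0: "1 - q = (\<Sum>y\<in>configs e. s0 y)"
    unfolding q1 by (simp flip: s01 add: sum.distrib)
  show "0 \<le> q" unfolding q1 by (intro sum_nonneg s1)
  have "0 \<le> 1 - q" unfolding q0 by (intro sum_nonneg s0)
  then show "q \<le> 1" by simp
  have M_ge: "t y \<le> M i (y i)" if "y \<in> configs e" "i \<in> e" for y i
    unfolding M[OF that(2), symmetric] using that t finc by (intro member_le_sum) auto
  have M_nn: "0 \<le> M i x" if "i \<in> e" for i x
    unfolding M[OF that, symmetric] by (intro sum_nonneg) (use t in auto)
  define L where "L i x = a x + b x * z i" for i x
  have L: "0 < L i x" for i x using pos by (simp add: L_def add_pos_pos)
  \<comment> \<open>The reference weights divide the vertex marginal \<open>M i x\<close> in the
    ratio of \<open>a x\<close> to \<open>b x * z i\<close>. They add up to \<open>M i x\<close>, as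
    the masses \<open>1 - q\<close> and \<open>q\<close> add up to 1, so the mass defects of the two
    parts cancel.\<close>
  define r0 where "r0 i x = M i x * a x / L i x" for i x
  define r1 where "r1 i x = M i x * (b x * z i) / L i x" for i x
  have M_pos: "0 < M i x" if "i \<in> e" "0 < (\<Sum>y | y \<in> configs e \<and> y i = x. s y)"
    "\<And>y. y \<in> configs e \<Longrightarrow> s y \<le> t y" for i x s
  proof -
    have "(\<Sum>y | y \<in> configs e \<and> y i = x. s y) \<le> M i x"
      unfolding M[OF that(1), symmetric] using that(3) by (intro sum_mono) auto
    then show ?thesis using that(2) by linarith
  qed
  have s_le: "s0 y \<le> t y" "s1 y \<le> t y" if "y \<in> configs e" for y
    using s01[of y] s0[OF that] s1[OF that] by linarith+
  have E0: "(\<Sum>y\<in>configs e. s0 y * (\<Sum>i\<in>e. ln (r0 i (y i)))) - (\<Sum>y\<in>configs e. s0 y * ln (s0 y))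
      \<le> (1 - q) * ln (1 - q) + (\<Sum>i\<in>e. (\<Sum>x\<in>UNIV. r0 i x) - (1 - q))"
  proof (rule split_edge_bound[OF e s0 _ _ refl q0])
    show "0 \<le> r0 i x" if "i \<in> e" for i x
      using M_nn[OF that, of x] pos(1)[of x] L[of i x] by (simp add: r0_def)
    show "0 < r0 i x" if "i \<in> e" "0 < (\<Sum>y | y \<in> configs e \<and> y i = x. s0 y)" for i x
      using M_pos[OF that s_le(1)] pos(1)[of x] L[of i x] by (simp add: r0_def)
  qed
  have E1: "(\<Sum>y\<in>configs e. s1 y * (\<Sum>i\<in>e. ln (r1 i (y i)))) - (\<Sum>y\<in>configs e. s1 y * ln (s1 y))
      \<le> q * ln q + (\<Sum>i\<in>e. (\<Sum>x\<in>UNIV. r1 i x) - q)"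
  proof (rule split_edge_bound[OF e s1 _ _ refl q1])
    show "0 \<le> r1 i x" if "i \<in> e" for i x
      using M_nn[OF that, of x] pos(2)[of x] pos(3)[of i] L[of i x] by (simp add: r1_def)
    show "0 < r1 i x" if "i \<in> e" "0 < (\<Sum>y | y \<in> configs e \<and> y i = x. s1 y)" for i x
      using M_pos[OF that s_le(2)] pos(2)[of x] pos(3)[of i] L[of i x] by (simp add: r1_def)
  qed
  have "r0 i x + r1 i x = M i x" for i x
    using L[of i x] by (simp add: r0_def r1_def L_def flip: add_divide_distrib distrib_left)
  then have r01: "(\<Sum>x\<in>UNIV. r0 i x) + (\<Sum>x\<in>UNIV. r1 i x) = 1" if "i \<in> e" for i
    using M1[OF that] by (simp flip: sum.distrib)
  have rsum: "(\<Sum>i\<in>e. (\<Sum>x\<in>UNIV. r0 i x) - (1 - q)) + (\<Sum>i\<in>e. (\<Sum>x\<in>UNIV. r1 i x) - q) = 0"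
    unfolding sum.distrib[symmetric] using r01 by (intro sum.neutral) (auto simp: algebra_simps)
  \<comment> \<open>In each part the logarithms of \<open>a\<close> or \<open>b\<close> cancel
    between the reference weights and the split marginal. The \<open>b\<close>-part keeps the extra
    \<open>ln (z i)\<close>; all other coefficients combine by
    \<open>s0 y + s1 y = t y\<close>.\<close>
  have pointwise: "s0 y * (\<Sum>i\<in>e. ln (r0 i (y i))) - s0 y * ln (s0 y)
      + (s1 y * (\<Sum>i\<in>e. ln (r1 i (y i))) - s1 y * ln (s1 y))
      = t y * ln (G y) - t y * ln (t y / (\<Prod>i\<in>e. M i (y i)))
        + s1 y * (\<Sum>i\<in>e. ln (z i)) - (\<Sum>i\<in>e. t y * ln (L i (y i)))"
    if y: "y \<in> configs e" for y
  proof (cases "t y = 0")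
    case True
    then show ?thesis by (simp add: s0_def s1_def)
  next
    case False
    then have ty: "0 < t y" using t[OF y] by simp
    then have Mp: "0 < M i (y i)" if "i \<in> e" for i using M_ge[OF y that] by linarith
    have ln3: "ln (p * q / r) = ln p + ln q - ln r" if "0 < p" "0 < q" "0 < r" for p q r :: real
      using that by (simp add: ln_mult ln_div)
    have r0_ln: "(\<Sum>i\<in>e. ln (r0 i (y i)))
        = (\<Sum>i\<in>e. ln (M i (y i))) + (\<Sum>i\<in>e. ln (a (y i))) - (\<Sum>i\<in>e. ln (L i (y i)))"
      unfolding sum.distrib[symmetric] sum_subtractf[symmetric] r0_def
      using Mp pos L by (intro sum.cong refl) (simp add: ln3)
    have r1_ln: "(\<Sum>i\<in>e. ln (r1 i (y i)))
        = (\<Sum>i\<in>e. ln (M i (y i))) + (\<Sum>i\<in>e. ln (b (y i))) + (\<Sum>i\<in>e. ln (z i)) - (\<Sum>i\<in>e. ln (L i (y i)))"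
      unfolding sum.distrib[symmetric] sum_subtractf[symmetric] r1_def
      using Mp pos L by (intro sum.cong refl) (simp add: ln3 ln_mult_pos)
    have s0_ln: "ln (s0 y) = ln (t y) + (\<Sum>i\<in>e. ln (a (y i))) - ln (G y)"
      using ty G[of y] pp(1)[of y] pos(1) by (simp add: s0_def ln_mult ln_div ln_prod fin less_imp_neq[symmetric])
    have s1_ln: "ln (s1 y) = ln (t y) + (\<Sum>i\<in>e. ln (b (y i))) - ln (G y)"
      using ty G[of y] pp(2)[of y] pos(2) by (simp add: s1_def ln_mult ln_div ln_prod fin less_imp_neq[symmetric])
    have "0 < (\<Prod>i\<in>e. M i (y i))" using Mp by (intro prod_pos) auto
    then have t_ln: "ln (t y / (\<Prod>i\<in>e. M i (y i))) = ln (t y) - (\<Sum>i\<in>e. ln (M i (y i)))"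
      using ty Mp by (simp add: ln_div ln_prod fin less_imp_neq[symmetric])
    show ?thesis
      unfolding r0_ln r1_ln s0_ln s1_ln t_ln sum_distrib_left[symmetric] unfolding s01[of y, symmetric]
      by (simp add: algebra_simps)
  qed
  have marg_L: "(\<Sum>y\<in>configs e. \<Sum>i\<in>e. t y * ln (L i (y i))) = (\<Sum>i\<in>e. \<Sum>x\<in>UNIV. M i x * ln (L i x))"
    by (subst sum.swap, subst sum_configs_marginal[OF fin]) (simp add: M)
  have "(\<Sum>y\<in>configs e. s0 y * (\<Sum>i\<in>e. ln (r0 i (y i))) - s0 y * ln (s0 y)
      + (s1 y * (\<Sum>i\<in>e. ln (r1 i (y i))) - s1 y * ln (s1 y)))
      = (\<Sum>y\<in>configs e. t y * ln (G y) - t y * ln (t y / (\<Prod>i\<in>e. M i (y i)))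
        + s1 y * (\<Sum>i\<in>e. ln (z i)) - (\<Sum>i\<in>e. t y * ln (L i (y i))))"
    by (intro sum.cong refl pointwise)
  then have "(\<Sum>y\<in>configs e. s0 y * (\<Sum>i\<in>e. ln (r0 i (y i)))) - (\<Sum>y\<in>configs e. s0 y * ln (s0 y))
      + ((\<Sum>y\<in>configs e. s1 y * (\<Sum>i\<in>e. ln (r1 i (y i)))) - (\<Sum>y\<in>configs e. s1 y * ln (s1 y)))
      = (\<Sum>y\<in>configs e. t y * ln (G y)) - (\<Sum>y\<in>configs e. t y * ln (t y / (\<Prod>i\<in>e. M i (y i))))
        + q * (\<Sum>i\<in>e. ln (z i)) - (\<Sum>i\<in>e. \<Sum>x\<in>UNIV. M i x * ln (L i x))"
    unfolding sum.distrib sum_subtractf marg_L q1 sum_distrib_right .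
  then show "(\<Sum>y\<in>configs e. t y * ln (edge_weight a b e y))
      - (\<Sum>y\<in>configs e. t y * ln (t y / (\<Prod>i\<in>e. M i (y i))))
    \<le> (\<Sum>i\<in>e. \<Sum>x\<in>UNIV. M i x * ln (a x + b x * z i)) - q * (\<Sum>i\<in>e. ln (z i)) - bin_entropy q"
    using E0 E1 rsum unfolding G_def[symmetric] L_def[symmetric] bin_entropy_def by linarith
qed

text \<open>Gibbs' variational principle at one vertex, by comparison with \<open>r\<close> divided
  by its total mass.\<close>

lemma sum_ln_minus_sum_ln_le:
  fixes p r :: "'x::finite \<Rightarrow> real"
  assumes "\<And>x. 0 \<le> p x" "(\<Sum>x\<in>UNIV. p x) = 1" "\<And>x. 0 < r x"
  shows "(\<Sum>x\<in>UNIV. p x * ln (r x)) - (\<Sum>x\<in>UNIV. p x * ln (p x)) \<le> ln (\<Sum>x\<in>UNIV. r x)"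
proof -
  define R where "R = (\<Sum>x\<in>UNIV. r x)"
  have R: "0 < R" unfolding R_def by (intro sum_pos) (auto simp: assms)
  have "(\<Sum>x\<in>UNIV. p x * ln (r x / R))
      \<le> (\<Sum>x\<in>UNIV. p x * ln (p x)) + (\<Sum>x\<in>UNIV. r x / R) - (\<Sum>x\<in>UNIV. p x)"
    using assms R by (intro gibbs_inequality) (auto intro: less_imp_le)
  also have "(\<Sum>x\<in>UNIV. r x / R) = 1"
    using R by (simp add: R_def flip: sum_divide_distrib)
  also have "(\<Sum>x\<in>UNIV. p x * ln (r x / R)) = (\<Sum>x\<in>UNIV. p x * ln (r x) - p x * ln R)"
    using assms(3) R by (intro sum.cong refl) (simp add: ln_divide_pos right_diff_distrib)
  also have "\<dots> = (\<Sum>x\<in>UNIV. p x * ln (r x)) - ln R"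
    using assms(2) by (simp add: sum_subtractf flip: sum_distrib_right)
  finally show ?thesis using assms(2) by (simp add: R_def)
qed

text \<open>Vanishing potentials occur only with coefficient 0, where the product with
  \<open>-\<infinity>\<close> in \<open>ereal\<close> and the product with \<open>ln 0\<close> in
  the reals are both 0.\<close>

lemma log_bethe_finite:
  fixes \<phi> :: "'v \<Rightarrow> 'x::finite \<Rightarrow> real"
  assumes "\<And>i x. i \<in> V \<Longrightarrow> \<phi> i x = 0 \<Longrightarrow> \<tau>v i x = 0"
    and "\<And>\<alpha> y. \<alpha> \<in> A \<Longrightarrow> y \<in> configs \<alpha> \<Longrightarrow> \<psi> \<alpha> y = 0 \<Longrightarrow> \<tau>e \<alpha> y = 0"
  shows "log_bethe V A \<phi> \<psi> (\<tau>v, \<tau>e) = ereal (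
      (\<Sum>i\<in>V. \<Sum>x\<in>UNIV. \<tau>v i x * ln (\<phi> i x))
    + (\<Sum>\<alpha>\<in>A. \<Sum>y\<in>configs \<alpha>. \<tau>e \<alpha> y * ln (\<psi> \<alpha> y))
    + (- (\<Sum>i\<in>V. \<Sum>x\<in>UNIV. \<tau>v i x * ln (\<tau>v i x))
       - (\<Sum>\<alpha>\<in>A. \<Sum>y\<in>configs \<alpha>. \<tau>e \<alpha> y * ln (\<tau>e \<alpha> y / (\<Prod>i\<in>\<alpha>. \<tau>v i (y i))))))"
proof -
  have "(\<Sum>i\<in>V. \<Sum>x\<in>UNIV. ereal (\<tau>v i x) * ext_ln (\<phi> i x))
      = (\<Sum>i\<in>V. \<Sum>x\<in>UNIV. ereal (\<tau>v i x * ln (\<phi> i x)))"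
    by (intro sum.cong refl) (auto simp: ext_ln_def assms(1) zero_ereal_def[symmetric])
  moreover have "(\<Sum>\<alpha>\<in>A. \<Sum>y\<in>configs \<alpha>. ereal (\<tau>e \<alpha> y) * ext_ln (\<psi> \<alpha> y))
      = (\<Sum>\<alpha>\<in>A. \<Sum>y\<in>configs \<alpha>. ereal (\<tau>e \<alpha> y * ln (\<psi> \<alpha> y)))"
    by (intro sum.cong refl) (auto simp: ext_ln_def assms(2) zero_ereal_def[symmetric])
  ultimately show ?thesis by (simp add: log_bethe_def)
qed

text \<open>The edge bounds hold for every positive \<open>z\<close>, and \<open>q\<close> depends
  only on the pseudomarginal, so \<open>z\<close> may be taken from \<open>edge_elimination\<close>
  for this \<open>q\<close>. The terms in \<open>ln (z e i)\<close> and the binary entropies then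
  cancel.\<close>

lemma log_bethe_le_ln_hom_sum:
  fixes a b :: "'x::finite \<Rightarrow> real" and \<omega> :: "'v \<Rightarrow> 'x \<Rightarrow> real"
  assumes G: "finite_simple_graph V E"
    and pos: "\<And>x. 0 < a x" "\<And>x. 0 < b x" "\<And>i x. 0 < \<omega> i x"
    and T: "(\<tau>v, \<tau>e) \<in> local_marginal_polytope V E"
  shows "log_bethe V E \<omega> (edge_weight a b) (\<tau>v, \<tau>e) \<le> ereal (ln (hom_sum V \<omega> a b E))"
proof -
  have V: "finite V" and E: "\<And>e. e \<in> E \<Longrightarrow> e \<subseteq> V \<and> card e = 2"
    using G by (auto simp: finite_simple_graph_def)
  have finE: "finite E"
    using E by (intro finite_subset[of E "Pow V"]) (auto simp: V)
  have tv: "0 \<le> \<tau>v i x" if "i \<in> V" for i x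
    using T that by (auto simp: local_marginal_polytope_def)
  have te: "0 \<le> \<tau>e e y" if "e \<in> E" "y \<in> configs e" for e y
    using T that by (auto simp: local_marginal_polytope_def)
  have tv1: "(\<Sum>x\<in>UNIV. \<tau>v i x) = 1" if "i \<in> V" for i
    using T that by (auto simp: local_marginal_polytope_def)
  have marg: "(\<Sum>y | y \<in> configs e \<and> y i = x. \<tau>e e y) = \<tau>v i x" if "e \<in> E" "i \<in> e" for e i x
    using T that by (auto simp: local_marginal_polytope_def)
  have tv1': "(\<Sum>x\<in>UNIV. \<tau>v i x) = 1" if "e \<in> E" "i \<in> e" for e i
    using E[OF that(1)] that(2) tv1 by blast
  define q where "q e = (\<Sum>y\<in>configs e. \<tau>e e y * (\<Prod>i\<in>e. b (y i)) / edge_weight a b e y)" for e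
  have edge: "(\<Sum>y\<in>configs e. \<tau>e e y * ln (edge_weight a b e y))
      - (\<Sum>y\<in>configs e. \<tau>e e y * ln (\<tau>e e y / (\<Prod>i\<in>e. \<tau>v i (y i))))
    \<le> (\<Sum>i\<in>e. \<Sum>x\<in>UNIV. \<tau>v i x * ln (a x + b x * z i)) - q e * (\<Sum>i\<in>e. ln (z i)) - bin_entropy (q e)"
    and q01: "0 \<le> q e" "q e \<le> 1" if "e \<in> E" "\<And>i. 0 < z i" for e z
    using edge_free_energy_bound[where z = z, OF conjunct2[OF E[OF that(1)]] pos(1,2) that(2) te[OF that(1)]
        marg[OF that(1)] tv1'[OF that(1)] q_def] by simp_all
  \<comment> \<open>The range of \<open>q e\<close> does not involve \<open>z\<close>; any positive
    value extracts it.\<close>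
  have "0 \<le> q e \<and> q e \<le> 1" if "e \<in> E" for e
    using q01[OF that, of "\<lambda>_. 1"] by simp
  then obtain z where z: "\<And>e i. 0 < z e i" and le:
    "(\<Sum>i\<in>V. ln (\<Sum>x\<in>UNIV. \<omega> i x * (\<Prod>e | e \<in> E \<and> i \<in> e. a x + b x * z e i)))
      \<le> ln (hom_sum V \<omega> a b E) + (\<Sum>e\<in>E. q e * (\<Sum>i\<in>e. ln (z e i)) + bin_entropy (q e))"
    using edge_elimination[of E V a b \<omega> q] finE V E pos by blast
  define L where "L e i x = a x + b x * z e i" for e i x
  have L: "0 < L e i x" for e i x using pos z by (simp add: L_def add_pos_pos)
  \<comment> \<open>The variational principle with the vertex weight multiplied by the factors of
    all incident edges, their logarithms being moved to the right-hand side.\<close>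
  have vertex: "(\<Sum>x\<in>UNIV. \<tau>v i x * ln (\<omega> i x)) - (\<Sum>x\<in>UNIV. \<tau>v i x * ln (\<tau>v i x))
      \<le> ln (\<Sum>x\<in>UNIV. \<omega> i x * (\<Prod>e | e \<in> E \<and> i \<in> e. L e i x))
        - (\<Sum>e | e \<in> E \<and> i \<in> e. \<Sum>x\<in>UNIV. \<tau>v i x * ln (L e i x))" if i: "i \<in> V" for i
  proof -
    have "(\<Sum>x\<in>UNIV. \<tau>v i x * ln (\<omega> i x * (\<Prod>e | e \<in> E \<and> i \<in> e. L e i x)))
        = (\<Sum>x\<in>UNIV. \<tau>v i x * ln (\<omega> i x) + (\<Sum>e | e \<in> E \<and> i \<in> e. \<tau>v i x * ln (L e i x)))"
    proof (intro sum.cong refl)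
      fix x
      have "ln (\<omega> i x * (\<Prod>e | e \<in> E \<and> i \<in> e. L e i x))
          = ln (\<omega> i x) + (\<Sum>e | e \<in> E \<and> i \<in> e. ln (L e i x))"
        using pos(3)[of i x] L finE
        by (simp add: ln_mult_pos ln_prod prod_pos less_imp_neq[symmetric])
      then show "\<tau>v i x * ln (\<omega> i x * (\<Prod>e | e \<in> E \<and> i \<in> e. L e i x))
          = \<tau>v i x * ln (\<omega> i x) + (\<Sum>e | e \<in> E \<and> i \<in> e. \<tau>v i x * ln (L e i x))"
        by (simp add: distrib_left sum_distrib_left)
    qed
    also have "\<dots> = (\<Sum>x\<in>UNIV. \<tau>v i x * ln (\<omega> i x))
        + (\<Sum>e | e \<in> E \<and> i \<in> e. \<Sum>x\<in>UNIV. \<tau>v i x * ln (L e i x))"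
      unfolding sum.distrib by (subst (2) sum.swap) simp
    finally show ?thesis
      using sum_ln_minus_sum_ln_le[of "\<tau>v i" "\<lambda>x. \<omega> i x * (\<Prod>e | e \<in> E \<and> i \<in> e. L e i x)"]
        tv[OF i] tv1[OF i] pos(3) L by (simp add: prod_pos)
  qed
  \<comment> \<open>Regrouping incidences by edges lets the terms with \<open>L\<close> in the
    vertex bounds cancel those in the edge bounds.\<close>
  have swap: "(\<Sum>i\<in>V. \<Sum>e | e \<in> E \<and> i \<in> e. f e i) = (\<Sum>e\<in>E. \<Sum>i\<in>e. f e i)"
    for f :: "'v set \<Rightarrow> 'v \<Rightarrow> real"
  proof -
    have "(\<Sum>i\<in>V. \<Sum>e | e \<in> E \<and> i \<in> e. f e i) = (\<Sum>e\<in>E. \<Sum>i | i \<in> V \<and> i \<in> e. f e i)"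
      by (rule sum.swap_restrict[OF V finE])
    also have "\<dots> = (\<Sum>e\<in>E. \<Sum>i\<in>e. f e i)"
      using E by (intro sum.cong refl) auto
    finally show ?thesis .
  qed
  have "(\<Sum>i\<in>V. (\<Sum>x\<in>UNIV. \<tau>v i x * ln (\<omega> i x)) - (\<Sum>x\<in>UNIV. \<tau>v i x * ln (\<tau>v i x)))
    \<le> (\<Sum>i\<in>V. ln (\<Sum>x\<in>UNIV. \<omega> i x * (\<Prod>e | e \<in> E \<and> i \<in> e. L e i x))
        - (\<Sum>e | e \<in> E \<and> i \<in> e. \<Sum>x\<in>UNIV. \<tau>v i x * ln (L e i x)))"
    by (intro sum_mono vertex)
  moreover have "(\<Sum>e\<in>E. (\<Sum>y\<in>configs e. \<tau>e e y * ln (edge_weight a b e y))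
      - (\<Sum>y\<in>configs e. \<tau>e e y * ln (\<tau>e e y / (\<Prod>i\<in>e. \<tau>v i (y i)))))
    \<le> (\<Sum>e\<in>E. (\<Sum>i\<in>e. \<Sum>x\<in>UNIV. \<tau>v i x * ln (L e i x)) - q e * (\<Sum>i\<in>e. ln (z e i)) - bin_entropy (q e))"
    unfolding L_def by (intro sum_mono edge z)
  moreover have "(\<Sum>i\<in>V. \<Sum>x\<in>UNIV. \<tau>v i x * ln (\<omega> i x))
    + (\<Sum>e\<in>E. \<Sum>y\<in>configs e. \<tau>e e y * ln (edge_weight a b e y))
    + (- (\<Sum>i\<in>V. \<Sum>x\<in>UNIV. \<tau>v i x * ln (\<tau>v i x))
       - (\<Sum>e\<in>E. \<Sum>y\<in>configs e. \<tau>e e y * ln (\<tau>e e y / (\<Prod>i\<in>e. \<tau>v i (y i)))))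
    \<le> ln (hom_sum V \<omega> a b E)"
    using calculation le unfolding L_def[symmetric] sum_subtractf sum.distrib swap by linarith
  moreover have "\<omega> i x \<noteq> 0" "edge_weight a b e y \<noteq> 0" for i x y and e :: "'v set"
    using pos(3) edge_weight_pos[of a b, OF pos(1,2)] by (metis less_irrefl)+
  ultimately show ?thesis by (subst log_bethe_finite) simp_all
qed

section \<open>Existence of the maxima\<close>

lemma continuous_on_mult_ln: "continuous_on {0..} (\<lambda>t::real. t * ln t)"
  unfolding continuous_on_eq_continuous_within
proof
  fix t :: real assume "t \<in> {0..}"
  then consider "t = 0" | "0 < t" by fastforce
  then show "continuous (at t within {0..}) (\<lambda>t. t * ln t)"
  proof cases
    case 1
    have "((\<lambda>t::real. t * ln t) \<longlongrightarrow> 0) (at_right 0)" by real_asymp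
    then show ?thesis using 1 by (simp add: continuous_within at_within_Ici_at_right)
  qed (auto intro!: continuous_intros)
qed

text \<open>Tychonoff's theorem; the index type may be infinite, as the vertex type is
  arbitrary.\<close>

lemma compact_functions_into:
  fixes C :: "'b::topological_space set"
  assumes "compact C"
  shows "compact {f :: 'a \<Rightarrow> 'b. \<forall>i. f i \<in> C}"
proof -
  have "compactin (product_topology (\<lambda>_::'a. euclidean) UNIV) (PiE UNIV (\<lambda>_. C))"
    using assms by (subst compactin_PiE) simp
  moreover have "PiE UNIV (\<lambda>_. C) = {f :: 'a \<Rightarrow> 'b. \<forall>i. f i \<in> C}"
    by (auto simp: PiE_iff)
  ultimately show ?thesis by (simp add: euclidean_product_topology)
qed

lemma continuous_on_fst_apply: "continuous_on S (\<lambda>\<tau>. fst \<tau> i x)"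
  by (rule continuous_on_product_then_coordinatewise[OF
      continuous_on_product_then_coordinatewise[OF continuous_on_fst[OF continuous_on_id]]])

lemma continuous_on_snd_apply: "continuous_on S (\<lambda>\<tau>. snd \<tau> i x)"
  by (rule continuous_on_product_then_coordinatewise[OF
      continuous_on_product_then_coordinatewise[OF continuous_on_snd[OF continuous_on_id]]])

lemmas continuous_on_coords [continuous_intros] = continuous_on_fst_apply continuous_on_snd_apply

lemma closed_Collect_const_imp: "closed {x. Q x} \<Longrightarrow> closed {x. P \<longrightarrow> Q x}"
  by (intro closed_Collect_imp open_Collect_const)

lemma closed_Collect_const_ball: "(\<And>i. i \<in> I \<Longrightarrow> closed {x. P i x}) \<Longrightarrow> closed {x. \<forall>i\<in>I. P i x}"
proof -
  assume P: "\<And>i. i \<in> I \<Longrightarrow> closed {x. P i x}"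
  have "closed {x. i \<in> I \<longrightarrow> P i x}" for i using P by (cases "i \<in> I") auto
  then show ?thesis unfolding Ball_def by (rule closed_Collect_all)
qed

lemma closed_local_marginal_polytope:
  "closed (local_marginal_polytope V A :: ('v, 'x::finite) pseudomarginal set)"
  unfolding local_marginal_polytope_def case_prod_unfold
  by (intro closed_Collect_conj closed_Collect_const_ball closed_Collect_all closed_Collect_le
      closed_Collect_eq continuous_intros)

lemma closed_mean_field_set:
  "closed (mean_field_set V A :: ('v, 'x::finite) pseudomarginal set)"
proof -
  have "mean_field_set V A = (local_marginal_polytope V A \<inter> {\<tau>. \<forall>\<alpha>\<in>A. \<forall>y\<in>configs \<alpha>.
      snd \<tau> \<alpha> y = (\<Prod>i\<in>\<alpha>. fst \<tau> i (y i))} :: ('v, 'x) pseudomarginal set)"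
    by (auto simp: mean_field_set_def)
  then show ?thesis
    by (auto intro!: closed_Int closed_local_marginal_polytope closed_Collect_const_ball
        closed_Collect_eq continuous_intros)
qed

text \<open>The constraint \<open>y i = x\<close> is absorbed into the factor at \<open>i\<close>.
  The sum then factorizes, and every other factor sums to 1.\<close>

lemma sum_configs_prod_marginal:
  fixes f :: "'v \<Rightarrow> 'x::finite \<Rightarrow> real"
  assumes "finite \<alpha>" "i \<in> \<alpha>" and f: "\<And>j. j \<in> \<alpha> \<Longrightarrow> (\<Sum>x\<in>UNIV. f j x) = 1"
  shows "(\<Sum>y | y \<in> configs \<alpha> \<and> y i = x. \<Prod>j\<in>\<alpha>. f j (y j)) = f i x"
proof -
  let ?g = "\<lambda>j z. if j = i \<and> z \<noteq> x then 0 else f j z"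
  have g: "(\<Prod>j\<in>\<alpha>. ?g j (y j)) = (if y i = x then \<Prod>j\<in>\<alpha>. f j (y j) else 0)" for y
    using assms(1,2) by (auto intro!: prod.cong prod_zero)
  have "(\<Sum>y | y \<in> configs \<alpha> \<and> y i = x. \<Prod>j\<in>\<alpha>. f j (y j)) = (\<Sum>y\<in>configs \<alpha>. \<Prod>j\<in>\<alpha>. ?g j (y j))"
    unfolding g by (rule sum.inter_filter[OF finite_configs[OF assms(1)]])
  also have "\<dots> = (\<Prod>j\<in>\<alpha>. \<Sum>z\<in>UNIV. ?g j z)"
    by (rule sum_configs_prod[OF assms(1)])
  also have "\<dots> = (\<Prod>j\<in>\<alpha>. if j = i then f i x else 1)"
  proof (intro prod.cong refl)
    fix j assume "j \<in> \<alpha>"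
    have "(\<Sum>z\<in>UNIV. if z \<noteq> x then 0 else f i z) = (\<Sum>z\<in>UNIV. if z = x then f i z else 0)"
      by (intro sum.cong) auto
    then show "(\<Sum>z\<in>UNIV. ?g j z) = (if j = i then f i x else 1)"
      using f[OF \<open>j \<in> \<alpha>\<close>] by auto
  qed
  also have "\<dots> = f i x" using assms(1,2) by simp
  finally show ?thesis .
qed

text \<open>The uniform distribution at every vertex, with its products on the hyperedges, is a
  member.\<close>

lemma mean_field_set_nonempty:
  assumes "finite V" "\<And>\<alpha>. \<alpha> \<in> A \<Longrightarrow> \<alpha> \<subseteq> V"
  shows "(mean_field_set V A :: ('v, 'x::finite) pseudomarginal set) \<noteq> {}"
proof -
  define u where "u = (\<lambda>(i::'v) (x::'x). 1 / real CARD('x))"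
  have u: "(\<Sum>x\<in>UNIV. u i x) = 1" "0 \<le> u i x" for i x by (simp_all add: u_def)
  have "(\<Sum>y | y \<in> configs \<alpha> \<and> y i = x. \<Prod>j\<in>\<alpha>. u j (y j)) = u i x" if "\<alpha> \<in> A" "i \<in> \<alpha>" for \<alpha> i x
    using that(2) finite_subset[OF assms(2)[OF that(1)] assms(1)] by (intro sum_configs_prod_marginal u(1))
  then have "(u, \<lambda>\<alpha> y. \<Prod>i\<in>\<alpha>. u i (y i)) \<in> mean_field_set V A"
    using u by (auto simp: mean_field_set_def local_marginal_polytope_def intro!: prod_nonneg)
  then show ?thesis by blast
qed

text \<open>
  The coordinates of a pseudomarginal that are irrelevant for \<open>V\<close> and \<open>A\<close> are unbounded on the local
  marginal polytope; setting them to \<open>0\<close> makes it compact in the product topology.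
\<close>

definition trim :: "'v set \<Rightarrow> 'v set set \<Rightarrow> ('v, 'x) pseudomarginal \<Rightarrow> ('v, 'x) pseudomarginal" where
  "trim V A = (\<lambda>(\<tau>v, \<tau>e). (\<lambda>i x. if i \<in> V then \<tau>v i x else 0,
     \<lambda>\<alpha> y. if \<alpha> \<in> A \<and> y \<in> configs \<alpha> then \<tau>e \<alpha> y else 0))"

lemma trim_local_marginal_polytope:
  assumes "\<And>\<alpha>. \<alpha> \<in> A \<Longrightarrow> \<alpha> \<subseteq> V" "\<tau> \<in> local_marginal_polytope V A"
  shows "trim V A \<tau> \<in> local_marginal_polytope V A"
proof -
  obtain \<tau>v \<tau>e where \<tau>: "\<tau> = (\<tau>v, \<tau>e)" by force
  have "(\<Sum>y | y \<in> configs \<alpha> \<and> y i = x. if \<alpha> \<in> A \<and> y \<in> configs \<alpha> then \<tau>e \<alpha> y else 0)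
      = (if i \<in> V then \<tau>v i x else 0)" if "\<alpha> \<in> A" "i \<in> \<alpha>" for \<alpha> i x
  proof -
    have "(\<Sum>y | y \<in> configs \<alpha> \<and> y i = x. if \<alpha> \<in> A \<and> y \<in> configs \<alpha> then \<tau>e \<alpha> y else 0)
        = (\<Sum>y | y \<in> configs \<alpha> \<and> y i = x. \<tau>e \<alpha> y)"
      using that by (intro sum.cong) auto
    then show ?thesis using assms that by (auto simp: \<tau> local_marginal_polytope_def)
  qed
  then show ?thesis using assms(2) by (auto simp: \<tau> trim_def local_marginal_polytope_def)
qed

lemma trim_mean_field_set:
  assumes "\<And>\<alpha>. \<alpha> \<in> A \<Longrightarrow> \<alpha> \<subseteq> V" "\<tau> \<in> mean_field_set V A"
  shows "trim V A \<tau> \<in> mean_field_set V A"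
proof -
  obtain \<tau>v \<tau>e where \<tau>: "\<tau> = (\<tau>v, \<tau>e)" by force
  have "trim V A \<tau> \<in> local_marginal_polytope V A"
    using assms by (intro trim_local_marginal_polytope) (auto simp: mean_field_set_def)
  moreover have "(\<Prod>i\<in>\<alpha>. if i \<in> V then \<tau>v i (y i) else 0) = (\<Prod>i\<in>\<alpha>. \<tau>v i (y i))"
    if "\<alpha> \<in> A" for \<alpha> y
    using assms(1)[OF that] by (intro prod.cong) auto
  ultimately show ?thesis
    using assms(2) by (auto simp: \<tau> trim_def mean_field_set_def)
qed

lemma log_bethe_trim:
  assumes "\<And>\<alpha>. \<alpha> \<in> A \<Longrightarrow> \<alpha> \<subseteq> V"
  shows "log_bethe V A \<phi> \<psi> (trim V A \<tau>) = log_bethe V A \<phi> \<psi> \<tau>"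
proof -
  have "(\<Prod>i\<in>\<alpha>. if i \<in> V then f i else 0) = (\<Prod>i\<in>\<alpha>. f i)" if "\<alpha> \<in> A" for \<alpha> and f :: "'a \<Rightarrow> real"
    using assms[OF that] by (intro prod.cong) auto
  then show ?thesis by (cases \<tau>) (simp add: log_bethe_def trim_def)
qed

text \<open>A hyperedge entry is bounded through the marginal at one of its vertices; on an empty
  hyperedge no marginal condition would bound it.\<close>

lemma local_marginal_polytope_le_1:
  assumes "(\<tau>v, \<tau>e) \<in> local_marginal_polytope V A"
  shows "i \<in> V \<Longrightarrow> \<tau>v i x \<le> 1"
    and "finite V \<Longrightarrow> \<alpha> \<in> A \<Longrightarrow> \<alpha> \<subseteq> V \<Longrightarrow> \<alpha> \<noteq> {} \<Longrightarrow> y \<in> configs \<alpha> \<Longrightarrow> \<tau>e \<alpha> y \<le> 1"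
proof -
  show v: "\<tau>v i x \<le> 1" if "i \<in> V" for i x
  proof -
    have "\<tau>v i x \<le> (\<Sum>x\<in>UNIV. \<tau>v i x)"
      using assms that by (intro member_le_sum) (auto simp: local_marginal_polytope_def)
    then show ?thesis using assms that by (auto simp: local_marginal_polytope_def)
  qed
  assume *: "finite V" "\<alpha> \<in> A" "\<alpha> \<subseteq> V" "\<alpha> \<noteq> {}" "y \<in> configs \<alpha>"
  obtain i where i: "i \<in> \<alpha>" using *(4) by blast
  have "\<tau>e \<alpha> y \<le> (\<Sum>y' | y' \<in> configs \<alpha> \<and> y' i = y i. \<tau>e \<alpha> y')"
    using assms * finite_configs[OF finite_subset[OF *(3,1)]]
    by (intro member_le_sum) (auto simp: local_marginal_polytope_def)
  also have "\<dots> = \<tau>v i (y i)" using assms * i by (auto simp: local_marginal_polytope_def)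
  also have "\<dots> \<le> 1" using v * i by blast
  finally show "\<tau>e \<alpha> y \<le> 1" .
qed

section \<open>Infinite values and attainment of the maximum\<close>

lemma sum_ereal_eq_minus_infinity:
  fixes f :: "'a \<Rightarrow> ereal"
  assumes "finite S" "\<And>x. x \<in> S \<Longrightarrow> f x \<noteq> \<infinity>" "x \<in> S" "f x = -\<infinity>"
  shows "sum f S = -\<infinity>"
proof -
  have "sum f S \<noteq> \<infinity>" using assms(2) by (simp add: sum_Pinfty)
  moreover have "\<bar>sum f S\<bar> = \<infinity>" using assms by (subst sum_Inf) force
  ultimately show ?thesis by auto
qed

lemma mult_ext_ln:
  assumes "0 \<le> t"
  shows "ereal t * ext_ln p \<noteq> \<infinity>" "p = 0 \<Longrightarrow> t \<noteq> 0 \<Longrightarrow> ereal t * ext_ln p = -\<infinity>"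
  using assms by (cases "t = 0", auto simp: ext_ln_def zero_ereal_def[symmetric])

text \<open>One summand is \<open>-\<infinity>\<close>. Since
  \<open>\<infinity> + -\<infinity> = \<infinity>\<close> in \<open>ereal\<close>, the point to
  check is that no partial sum is \<open>\<infinity>\<close>.\<close>

lemma log_bethe_eq_minus_infinity:
  fixes \<tau>v :: "'v \<Rightarrow> 'x::finite \<Rightarrow> real"
  assumes fin: "finite V" "finite A" "\<And>\<alpha>. \<alpha> \<in> A \<Longrightarrow> finite \<alpha>"
    and T: "(\<tau>v, \<tau>e) \<in> local_marginal_polytope V A"
    and bad: "(\<exists>i\<in>V. \<exists>x. \<phi> i x = 0 \<and> \<tau>v i x \<noteq> 0)
      \<or> (\<exists>\<alpha>\<in>A. \<exists>y\<in>configs \<alpha>. \<psi> \<alpha> y = 0 \<and> \<tau>e \<alpha> y \<noteq> 0)"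
  shows "log_bethe V A \<phi> \<psi> (\<tau>v, \<tau>e) = -\<infinity>"
proof -
  let ?v = "\<lambda>i. \<Sum>x\<in>UNIV. ereal (\<tau>v i x) * ext_ln (\<phi> i x)"
  let ?e = "\<lambda>\<alpha>. \<Sum>y\<in>configs \<alpha>. ereal (\<tau>e \<alpha> y) * ext_ln (\<psi> \<alpha> y)"
  have tv: "0 \<le> \<tau>v i x" if "i \<in> V" for i x
    using T that by (auto simp: local_marginal_polytope_def)
  have te: "0 \<le> \<tau>e \<alpha> y" if "\<alpha> \<in> A" "y \<in> configs \<alpha>" for \<alpha> y
    using T that by (auto simp: local_marginal_polytope_def)
  have v: "?v i \<noteq> \<infinity>" if "i \<in> V" for i
    unfolding sum_Pinfty using mult_ext_ln(1)[OF tv[OF that]] by blast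
  have e: "?e \<alpha> \<noteq> \<infinity>" if "\<alpha> \<in> A" for \<alpha>
    unfolding sum_Pinfty using mult_ext_ln(1)[OF te[OF that]] by blast
  have V: "sum ?v V \<noteq> \<infinity>" and E: "sum ?e A \<noteq> \<infinity>"
    using v e by (auto simp: sum_Pinfty)
  from bad have "sum ?v V = -\<infinity> \<or> sum ?e A = -\<infinity>"
  proof (elim disjE bexE exE conjE)
    fix i x assume *: "i \<in> V" "\<phi> i x = 0" "\<tau>v i x \<noteq> 0"
    have "?v i = -\<infinity>"
    proof (rule sum_ereal_eq_minus_infinity)
      show "ereal (\<tau>v i x) * ext_ln (\<phi> i x) = -\<infinity>"
        using mult_ext_ln(2)[OF tv[OF *(1)] *(2,3)] .
    qed (use mult_ext_ln(1)[OF tv[OF *(1)]] in auto)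
    then have "sum ?v V = -\<infinity>" by (rule sum_ereal_eq_minus_infinity[where f = ?v, OF fin(1) _ *(1), rotated]) (rule v)
    then show ?thesis ..
  next
    fix \<alpha> y assume *: "\<alpha> \<in> A" "y \<in> configs \<alpha>" "\<psi> \<alpha> y = 0" "\<tau>e \<alpha> y \<noteq> 0"
    have "?e \<alpha> = -\<infinity>"
    proof (rule sum_ereal_eq_minus_infinity)
      show "ereal (\<tau>e \<alpha> y) * ext_ln (\<psi> \<alpha> y) = -\<infinity>"
        using mult_ext_ln(2)[OF te[OF *(1,2)] *(3,4)] .
      show "finite (configs \<alpha> :: ('v \<Rightarrow> 'x) set)" by (rule finite_configs[OF fin(3)[OF *(1)]])
      show "ereal (\<tau>e \<alpha> y) * ext_ln (\<psi> \<alpha> y) \<noteq> \<infinity>" if "y \<in> configs \<alpha>" for y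
        by (rule mult_ext_ln(1)[OF te[OF *(1) that]])
    qed (rule *(2))
    then have "sum ?e A = -\<infinity>" by (rule sum_ereal_eq_minus_infinity[where f = ?e, OF fin(2) _ *(1), rotated]) (rule e)
    then show ?thesis ..
  qed
  then have "sum ?v V + sum ?e A = -\<infinity>" using V E by auto
  then show ?thesis by (simp add: log_bethe_def)
qed

text \<open>A positive \<open>t y\<close> makes all marginals at \<open>y\<close> positive, so the
  logarithm of the quotient splits. Only terms of the form \<open>s * ln s\<close> remain, which are
  continuous on \<open>{0..}\<close>.\<close>

lemma edge_entropy_marginal:
  fixes t :: "('v \<Rightarrow> 'x::finite) \<Rightarrow> real"
  assumes fin: "finite \<alpha>" and t: "\<And>y. y \<in> configs \<alpha> \<Longrightarrow> 0 \<le> t y"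
    and M: "\<And>i x. i \<in> \<alpha> \<Longrightarrow> (\<Sum>y | y \<in> configs \<alpha> \<and> y i = x. t y) = M i x"
  shows "(\<Sum>y\<in>configs \<alpha>. t y * ln (t y / (\<Prod>i\<in>\<alpha>. M i (y i))))
    = (\<Sum>y\<in>configs \<alpha>. t y * ln (t y)) - (\<Sum>i\<in>\<alpha>. \<Sum>x\<in>UNIV. M i x * ln (M i x))"
proof -
  have "t y * ln (t y / (\<Prod>i\<in>\<alpha>. M i (y i))) = t y * ln (t y) - (\<Sum>i\<in>\<alpha>. t y * ln (M i (y i)))"
    if y: "y \<in> configs \<alpha>" for y
  proof (cases "t y = 0")
    case False
    then have ty: "0 < t y" using t[OF y] by simp
    have Mp: "0 < M i (y i)" if "i \<in> \<alpha>" for i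
    proof -
      have "t y \<le> M i (y i)"
        unfolding M[OF that, symmetric] using y t finite_configs[OF fin] by (intro member_le_sum) auto
      then show ?thesis using ty by linarith
    qed
    then have "0 < (\<Prod>i\<in>\<alpha>. M i (y i))" by (intro prod_pos) auto
    then have "ln (t y / (\<Prod>i\<in>\<alpha>. M i (y i))) = ln (t y) - (\<Sum>i\<in>\<alpha>. ln (M i (y i)))"
      using ty Mp by (simp add: ln_div ln_prod fin less_imp_neq[symmetric])
    then show ?thesis by (simp add: right_diff_distrib sum_distrib_left)
  qed simp
  then have "(\<Sum>y\<in>configs \<alpha>. t y * ln (t y / (\<Prod>i\<in>\<alpha>. M i (y i))))
      = (\<Sum>y\<in>configs \<alpha>. t y * ln (t y)) - (\<Sum>y\<in>configs \<alpha>. \<Sum>i\<in>\<alpha>. t y * ln (M i (y i)))"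
    by (simp add: sum_subtractf)
  also have "(\<Sum>y\<in>configs \<alpha>. \<Sum>i\<in>\<alpha>. t y * ln (M i (y i))) = (\<Sum>i\<in>\<alpha>. \<Sum>x\<in>UNIV. M i x * ln (M i x))"
    by (subst sum.swap, subst sum_configs_marginal[OF fin]) (simp add: M)
  finally show ?thesis .
qed

text \<open>Stated for closed sets stable under \<open>trim\<close>, to cover both the polytope and
  the mean-field set. If \<open>N\<close> is empty, all values are 0. Otherwise a maximizer over the
  compact set \<open>K \<inter> N\<close> works: trimming carries points of \<open>N\<close> there
  without changing their value, and the remaining points of \<open>S\<close> have value 0.\<close>

lemma bethe_maximum_exists:
  fixes \<phi> :: "'v \<Rightarrow> 'x::finite \<Rightarrow> real" and S :: "('v, 'x) pseudomarginal set"
  assumes V: "finite V" and A: "\<And>\<alpha>. \<alpha> \<in> A \<Longrightarrow> \<alpha> \<subseteq> V \<and> \<alpha> \<noteq> {}"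
    and S: "closed S" "S \<noteq> {}" "S \<subseteq> local_marginal_polytope V A"
    and trim: "\<And>\<tau>. \<tau> \<in> S \<Longrightarrow> trim V A \<tau> \<in> S"
  shows "\<exists>\<tau>\<in>S. \<forall>\<tau>'\<in>S. ext_exp (log_bethe V A \<phi> \<psi> \<tau>') \<le> ext_exp (log_bethe V A \<phi> \<psi> \<tau>)"
proof -
  have finA: "finite A" using A V by (intro finite_subset[of A "Pow V"]) auto
  have fin\<alpha>: "finite \<alpha>" if "\<alpha> \<in> A" for \<alpha> using A[OF that] V finite_subset by blast
  define N where "N = S \<inter> {\<tau>. (\<forall>i\<in>V. \<forall>x. \<phi> i x = 0 \<longrightarrow> fst \<tau> i x = 0)
     \<and> (\<forall>\<alpha>\<in>A. \<forall>y\<in>configs \<alpha>. \<psi> \<alpha> y = 0 \<longrightarrow> snd \<tau> \<alpha> y = 0)}"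
  have zero: "ext_exp (log_bethe V A \<phi> \<psi> \<tau>) = 0" if "\<tau> \<in> S" "\<tau> \<notin> N" for \<tau>
  proof -
    obtain \<tau>v \<tau>e where \<tau>: "\<tau> = (\<tau>v, \<tau>e)" by force
    have "log_bethe V A \<phi> \<psi> (\<tau>v, \<tau>e) = -\<infinity>"
      using that S(3) by (intro log_bethe_eq_minus_infinity V finA fin\<alpha>) (auto simp: N_def \<tau>)
    then show ?thesis by (simp add: \<tau> ext_exp_def)
  qed
  show ?thesis
  proof (cases "N = {}")
    case True
    then show ?thesis using S(2) zero by fastforce
  next
    case False
    define K where "K = ({f. \<forall>i. f i \<in> {f. \<forall>x. f x \<in> {0..1}}} \<times> {f. \<forall>i. f i \<in> {f. \<forall>x. f x \<in> {0..1}}} ::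
        ('v, 'x) pseudomarginal set)"
    have K: "compact K" unfolding K_def by (intro compact_Times compact_functions_into compact_Icc)
    have "closed N" unfolding N_def
      by (intro closed_Int S(1) closed_Collect_conj closed_Collect_const_ball closed_Collect_all
          closed_Collect_const_imp closed_Collect_eq continuous_intros)
    then have cpt: "compact (K \<inter> N)" by (rule compact_Int_closed[OF K])
    have trimN: "trim V A \<tau> \<in> K \<inter> N" if "\<tau> \<in> N" for \<tau>
    proof -
      obtain \<tau>v \<tau>e where \<tau>: "\<tau> = (\<tau>v, \<tau>e)" by force
      have T: "(\<tau>v, \<tau>e) \<in> local_marginal_polytope V A" using that S(3) by (auto simp: N_def \<tau>)
      have "trim V A \<tau> \<in> K"
        using T local_marginal_polytope_le_1(1)[OF T] local_marginal_polytope_le_1(2)[OF T V] A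
        by (auto simp: \<tau> K_def trim_def local_marginal_polytope_def)
      moreover have "trim V A \<tau> \<in> N"
        using that trim[of \<tau>] by (auto simp: N_def \<tau> trim_def)
      ultimately show ?thesis by blast
    qed
    then have ne: "K \<inter> N \<noteq> {}" using False by blast
    \<comment> \<open>On \<open>N\<close> no logarithm of a vanishing potential contributes, so the upper semicontinuous Bethe
      functional is continuous there; outside \<open>N\<close> it is \<open>-\<infinity>\<close>.\<close>
    define f where "f \<tau> = (\<Sum>i\<in>V. \<Sum>x\<in>UNIV. fst \<tau> i x * ln (\<phi> i x))
      + (\<Sum>\<alpha>\<in>A. \<Sum>y\<in>configs \<alpha>. snd \<tau> \<alpha> y * ln (\<psi> \<alpha> y))
      + (- (\<Sum>i\<in>V. \<Sum>x\<in>UNIV. fst \<tau> i x * ln (fst \<tau> i x))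
         - (\<Sum>\<alpha>\<in>A. (\<Sum>y\<in>configs \<alpha>. snd \<tau> \<alpha> y * ln (snd \<tau> \<alpha> y))
             - (\<Sum>i\<in>\<alpha>. \<Sum>x\<in>UNIV. fst \<tau> i x * ln (fst \<tau> i x))))" for \<tau> :: "('v, 'x) pseudomarginal"
    have f: "log_bethe V A \<phi> \<psi> \<tau> = ereal (f \<tau>)" if "\<tau> \<in> N" for \<tau>
    proof -
      obtain \<tau>v \<tau>e where \<tau>: "\<tau> = (\<tau>v, \<tau>e)" by force
      have T: "(\<tau>v, \<tau>e) \<in> local_marginal_polytope V A" using that S(3) by (auto simp: N_def \<tau>)
      have "(\<Sum>\<alpha>\<in>A. \<Sum>y\<in>configs \<alpha>. \<tau>e \<alpha> y * ln (\<tau>e \<alpha> y / (\<Prod>i\<in>\<alpha>. \<tau>v i (y i))))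
        = (\<Sum>\<alpha>\<in>A. (\<Sum>y\<in>configs \<alpha>. \<tau>e \<alpha> y * ln (\<tau>e \<alpha> y)) - (\<Sum>i\<in>\<alpha>. \<Sum>x\<in>UNIV. \<tau>v i x * ln (\<tau>v i x)))"
        using T by (intro sum.cong refl edge_entropy_marginal fin\<alpha>) (auto simp: local_marginal_polytope_def)
      then show ?thesis
        using that unfolding \<tau> by (subst log_bethe_finite) (auto simp: N_def f_def)
    qed
    have entropy: "continuous_on (K \<inter> N) (\<lambda>\<tau>. fst \<tau> i x * ln (fst \<tau> i x))"
      "continuous_on (K \<inter> N) (\<lambda>\<tau>. snd \<tau> \<alpha> y * ln (snd \<tau> \<alpha> y))" for i x \<alpha> y
      by (rule continuous_on_compose2[OF continuous_on_mult_ln], intro continuous_intros, force simp: K_def)+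
    have "continuous_on (K \<inter> N) f" unfolding f_def
      by (intro continuous_on_add continuous_on_diff continuous_on_minus continuous_on_sum entropy
          continuous_on_mult_right continuous_on_coords)
    from continuous_attains_sup[OF cpt ne this] obtain \<tau> where \<tau>: "\<tau> \<in> K \<inter> N" "\<And>\<tau>'. \<tau>' \<in> K \<inter> N \<Longrightarrow> f \<tau>' \<le> f \<tau>"
      by blast
    have ext: "ext_exp (log_bethe V A \<phi> \<psi> \<tau>') = exp (f \<tau>')" if "\<tau>' \<in> N" for \<tau>'
      using f[OF that] by (simp add: ext_exp_def)
    have "ext_exp (log_bethe V A \<phi> \<psi> \<tau>') \<le> ext_exp (log_bethe V A \<phi> \<psi> \<tau>)" if "\<tau>' \<in> S" for \<tau>'
    proof (cases "\<tau>' \<in> N")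
      case True
      have "ext_exp (log_bethe V A \<phi> \<psi> \<tau>') = ext_exp (log_bethe V A \<phi> \<psi> (trim V A \<tau>'))"
        using A by (subst log_bethe_trim) auto
      also have "\<dots> = exp (f (trim V A \<tau>'))" using trimN[OF True] by (intro ext) blast
      also have "\<dots> \<le> exp (f \<tau>)" using \<tau>(2)[OF trimN[OF True]] by simp
      also have "\<dots> = ext_exp (log_bethe V A \<phi> \<psi> \<tau>)" using \<tau>(1) by (simp add: ext)
      finally show ?thesis .
    next
      case False
      then show ?thesis using \<tau>(1) by (simp add: zero[OF that False] ext)
    qed
    moreover have "\<tau> \<in> S" using \<tau>(1) by (simp add: N_def)
    ultimately show ?thesis by (intro bexI[of _ \<tau>] ballI)
  qed
qed

text \<open>\<open>GREATEST\<close> is informative only when the maximum is attained; a maximizer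
  identifies its value.\<close>

lemma bethe_Greatest:
  fixes \<phi> :: "'v \<Rightarrow> 'x::finite \<Rightarrow> real" and S :: "('v, 'x) pseudomarginal set"
  assumes "\<exists>\<tau>\<in>S. \<forall>\<tau>'\<in>S. ext_exp (log_bethe V A \<phi> \<psi> \<tau>') \<le> ext_exp (log_bethe V A \<phi> \<psi> \<tau>)"
  defines "Z \<equiv> (GREATEST z. \<exists>\<tau>\<in>S. z = ext_exp (log_bethe V A \<phi> \<psi> \<tau>))"
  shows "\<exists>\<tau>\<in>S. Z = ext_exp (log_bethe V A \<phi> \<psi> \<tau>)" "\<tau> \<in> S \<Longrightarrow> ext_exp (log_bethe V A \<phi> \<psi> \<tau>) \<le> Z"
proof -
  obtain \<tau>0 where \<tau>0: "\<tau>0 \<in> S" "\<forall>\<tau>'\<in>S. ext_exp (log_bethe V A \<phi> \<psi> \<tau>') \<le> ext_exp (log_bethe V A \<phi> \<psi> \<tau>0)"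
    using assms(1) by blast
  have "Z = ext_exp (log_bethe V A \<phi> \<psi> \<tau>0)"
    unfolding Z_def using \<tau>0 by (intro Greatest_equality) auto
  then show "\<exists>\<tau>\<in>S. Z = ext_exp (log_bethe V A \<phi> \<psi> \<tau>)" "\<tau> \<in> S \<Longrightarrow> ext_exp (log_bethe V A \<phi> \<psi> \<tau>) \<le> Z"
    using \<tau>0 by auto
qed

section \<open>Nonnegative parameters\<close>

lemma ext_ln_mono: "0 \<le> p \<Longrightarrow> p \<le> p' \<Longrightarrow> ext_ln p \<le> ext_ln p'"
  by (auto simp: ext_ln_def)

lemma log_bethe_mono:
  assumes T: "\<tau> \<in> local_marginal_polytope V A"
    and "\<And>i x. i \<in> V \<Longrightarrow> 0 \<le> \<phi> i x \<and> \<phi> i x \<le> \<phi>' i x"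
    and "\<And>\<alpha> y. \<alpha> \<in> A \<Longrightarrow> 0 \<le> \<psi> \<alpha> y \<and> \<psi> \<alpha> y \<le> \<psi>' \<alpha> y"
  shows "log_bethe V A \<phi> \<psi> \<tau> \<le> log_bethe V A \<phi>' \<psi>' \<tau>"
proof -
  obtain \<tau>v \<tau>e where \<tau>: "\<tau> = (\<tau>v, \<tau>e)" by force
  show ?thesis
    using T assms(2,3) unfolding \<tau> log_bethe_def prod.case
    by (intro add_mono sum_mono ereal_mult_left_mono ext_ln_mono order_refl)
      (auto simp: local_marginal_polytope_def)
qed

lemma edge_weight_nonneg:
  assumes "\<And>x. 0 \<le> a x" "\<And>x. 0 \<le> b x"
  shows "0 \<le> edge_weight a b e \<sigma>"
  using assms by (simp add: edge_weight_def prod_nonneg)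

lemma edge_weight_mono:
  assumes "\<And>x. 0 \<le> a x \<and> a x \<le> a' x" "\<And>x. 0 \<le> b x \<and> b x \<le> b' x"
  shows "edge_weight a b e \<sigma> \<le> edge_weight a' b' e \<sigma>"
  unfolding edge_weight_def using assms by (intro add_mono prod_mono) auto

lemma ext_exp_le_exp: "L \<le> ereal r \<Longrightarrow> ext_exp L \<le> exp r"
  by (cases L) (auto simp: ext_exp_def)

text \<open>With \<open>\<tau>\<close> fixed, adding \<open>\<epsilon> > 0\<close> to all entries of
  \<open>w\<close>, \<open>a\<close> and \<open>b\<close> can only increase the Bethe functional and
  leads to the positive case. The right-hand side is a polynomial in \<open>\<epsilon>\<close> and
  tends to the unperturbed sum.\<close>

lemma ext_exp_log_bethe_le_hom_sum:
  fixes w a b :: "'x::finite \<Rightarrow> real"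
  assumes G: "finite_simple_graph V E"
    and nn: "\<And>x. 0 \<le> w x" "\<And>x. 0 \<le> a x" "\<And>x. 0 \<le> b x"
    and T: "\<tau> \<in> local_marginal_polytope V E"
  shows "ext_exp (log_bethe V E (\<lambda>i. w) (edge_weight a b) \<tau>) \<le> hom_sum V (\<lambda>i. w) a b E"
    (is "?L \<le> _")
proof -
  define H where "H \<epsilon> = hom_sum V (\<lambda>i x. w x + \<epsilon>) (\<lambda>x. a x + \<epsilon>) (\<lambda>x. b x + \<epsilon>) E" for \<epsilon>
  have le: "?L \<le> H \<epsilon>" if \<epsilon>: "0 < \<epsilon>" for \<epsilon>
  proof -
    have pos: "0 < w x + \<epsilon>" "0 < a x + \<epsilon>" "0 < b x + \<epsilon>" for x
      using nn \<epsilon> by (simp_all add: add_nonneg_pos)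
    have "log_bethe V E (\<lambda>i. w) (edge_weight a b) \<tau>
        \<le> log_bethe V E (\<lambda>i x. w x + \<epsilon>) (edge_weight (\<lambda>x. a x + \<epsilon>) (\<lambda>x. b x + \<epsilon>)) \<tau>"
      using nn \<epsilon> by (intro log_bethe_mono[OF T] conjI edge_weight_nonneg edge_weight_mono) auto
    also have "\<dots> \<le> ereal (ln (H \<epsilon>))"
      using T unfolding H_def by (cases \<tau>) (simp add: log_bethe_le_ln_hom_sum[OF G] pos)
    finally have "?L \<le> exp (ln (H \<epsilon>))" by (rule ext_exp_le_exp)
    moreover have "0 < H \<epsilon>"
      using G unfolding H_def by (intro hom_sum_pos pos) (simp add: finite_simple_graph_def)
    ultimately show ?thesis by simp
  qed
  have "(H \<longlongrightarrow> hom_sum V (\<lambda>i x. w x + 0) (\<lambda>x. a x + 0) (\<lambda>x. b x + 0) E) (at_right 0)"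
    unfolding H_def hom_sum_def edge_weight_def by (intro tendsto_intros)
  moreover have "\<forall>\<^sub>F \<epsilon> in at_right 0. ?L \<le> H \<epsilon>"
    using eventually_at_right_less le by (rule eventually_mono)
  ultimately have "?L \<le> hom_sum V (\<lambda>i x. w x + 0) (\<lambda>x. a x + 0) (\<lambda>x. b x + 0) E"
    by (rule tendsto_lowerbound) simp
  then show ?thesis by simp
qed

section \<open>Transfer to the matrix model\<close>

theorem theorem6p2:
  fixes V :: "'v set" and E :: "'v set set"
    and w a b :: "real ^ 'n" and \<Gamma> :: "real ^ 'n ^ 'n"
  assumes "finite_simple_graph V E"
    and "\<forall>x. 0 \<le> w $ x"
    and "\<forall>x. 0 \<le> a $ x"
    and "\<forall>x. 0 \<le> b $ x"
    and "\<Gamma> = (columnvector a :: real ^ 1 ^ 'n) ** transpose (columnvector a)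
            + (columnvector b :: real ^ 1 ^ 'n) ** transpose (columnvector b)"
  shows "Z_mean_field_hom V E w \<Gamma> \<le> Z_bethe_hom V E w \<Gamma>
       \<and> Z_bethe_hom V E w \<Gamma> \<le> Z_hom V E w \<Gamma>"
proof -
  have V: "finite V" and E: "\<And>e. e \<in> E \<Longrightarrow> e \<subseteq> V \<and> card e = 2"
    using assms(1) by (auto simp: finite_simple_graph_def)
  have E': "\<And>e. e \<in> E \<Longrightarrow> e \<subseteq> V \<and> e \<noteq> {}" using E by fastforce
  let ?\<psi> = "edge_weight (($) a) (($) b) :: 'v set \<Rightarrow> ('v \<Rightarrow> 'n) \<Rightarrow> real"
  let ?B = "log_bethe V E (hom_vertex_potential w) (hom_edge_potential \<Gamma>)"
  have \<Gamma>: "\<Gamma> $ x $ y = a $ x * a $ y + b $ x * b $ y" for x y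
    by (simp add: assms(5) matrix_matrix_mult_def columnvector_def transpose_def)
  \<comment> \<open>Symmetry makes the value of \<open>hom_edge_potential\<close> independent of the
    order of the end points.\<close>
  have sym: "transpose \<Gamma> = \<Gamma>"
    by (simp add: vec_eq_iff transpose_def \<Gamma> mult.commute)
  have pot: "hom_edge_potential \<Gamma> e \<sigma> = ?\<psi> e \<sigma>" if e: "e \<in> E" for e \<sigma>
  proof -
    obtain i j where "e = {i, j}" "i \<noteq> j" using E[OF e] by (auto simp: card_2_iff)
    then show ?thesis by (simp add: hom_edge_potential_pair[OF sym] \<Gamma> edge_weight_def)
  qed
  have B: "?B = log_bethe V E (\<lambda>i. ($) w) ?\<psi>"
    unfolding log_bethe_def hom_vertex_potential_def by (simp add: pot cong: sum.cong)
  have Z: "Z_hom V E w \<Gamma> = hom_sum V (\<lambda>i. ($) w) (($) a) (($) b) E"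
    unfolding Z_hom_def hom_sum_def by (simp add: pot cong: prod.cong)
  have sub: "mean_field_set V E \<subseteq> (local_marginal_polytope V E :: ('v, 'n) pseudomarginal set)"
    by (auto simp: mean_field_set_def)
  have MF: "(mean_field_set V E :: ('v, 'n) pseudomarginal set) \<noteq> {}"
    using E by (intro mean_field_set_nonempty[OF V]) auto
  have maxT: "\<exists>\<tau>\<in>local_marginal_polytope V E. \<forall>\<tau>'\<in>local_marginal_polytope V E.
      ext_exp (?B \<tau>') \<le> ext_exp (?B \<tau>)"
    using sub MF E
    by (intro bethe_maximum_exists[OF V E' closed_local_marginal_polytope]
        trim_local_marginal_polytope) auto
  have maxM: "\<exists>\<tau>\<in>mean_field_set V E. \<forall>\<tau>'\<in>mean_field_set V E. ext_exp (?B \<tau>') \<le> ext_exp (?B \<tau>)"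
    using sub MF E
    by (intro bethe_maximum_exists[OF V E' closed_mean_field_set] trim_mean_field_set) auto
  obtain \<tau> where \<tau>: "\<tau> \<in> mean_field_set V E" "Z_mean_field_hom V E w \<Gamma> = ext_exp (?B \<tau>)"
    using bethe_Greatest(1)[OF maxM] unfolding Z_mean_field_hom_def Z_mean_field_def by blast
  \<comment> \<open>The mean-field maximizer competes in the maximum over the larger
    polytope.\<close>
  have "Z_mean_field_hom V E w \<Gamma> \<le> Z_bethe_hom V E w \<Gamma>"
    using bethe_Greatest(2)[OF maxT subsetD[OF sub \<tau>(1)]]
    by (simp add: \<tau>(2) Z_bethe_hom_def Z_bethe_def)
  moreover obtain \<tau>' where "\<tau>' \<in> local_marginal_polytope V E" "Z_bethe_hom V E w \<Gamma> = ext_exp (?B \<tau>')"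
    using bethe_Greatest(1)[OF maxT] unfolding Z_bethe_hom_def Z_bethe_def by blast
  ultimately show ?thesis
    using ext_exp_log_bethe_le_hom_sum[OF assms(1), of "($) w" "($) a" "($) b" \<tau>'] assms(2-4)
    by (simp add: B Z)
qed

end
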